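(* Let $f\colon\mathbf{R}^n\to\overline{\mathbf{R}}$ be a proper, stratifiable function that is finite at $\bar x$. Suppose that there is a neighborhood of $\bar x$ such that $f$ is vertically continuous and directionally Lipschitzian at every point of $\operatorname{dom} f$ in that neighborhood. Then for any dense subset $\Omega\subset\operatorname{dom} f$ we have $$N^{c}_{\operatorname{epi} f}(\bar x,f(\bar x))=\operatorname{coco}\Big\{\lim_{i\to\infty}\frac{(\nabla f(x_i),-1)}{\sqrt{1+|\nabla f(x_i)|^2}} : x_i\xrightarrow[f]{\Omega}\bar x\Big\}+\big(N^{c}_{\operatorname{dom} f}(\bar x)\times\{0\}\big).$$ Consequently, the Clarke subdifferential admits the presentation $$\partial_c f(\bar x)=\operatorname{conv}\Big\{\lim_{i\to\infty}\nabla f(x_i): x_i\xrightarrow[f]{\Omega}\bar x\Big\}+\operatorname{coco}\Big\{\lim_{i\to\infty,\ t_i\downarrow 0} t_i\nabla f(x_i): x_i\xrightarrow[f]{\Omega}\bar x\Big\}+N^{c}_{\operatorname{dom} f}(\bar x).$$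
   Context: Notation: $\overline{\mathbf{R}}=\mathbf{R}\cup\{\pm\infty\}$; $|\cdot|$ is the Euclidean norm; $f$ is proper if it never equals $-\infty$ and is not identically $+\infty$; $\operatorname{dom} f=\{x: f(x)<+\infty\}$; $\operatorname{epi} f=\{(x,r)\in\mathbf{R}^n\times\mathbf{R}: r\ge f(x)\}$. $\operatorname{conv}$ is the convex hull (with $\operatorname{conv}\emptyset=\emptyset$) and $\operatorname{coco} A$ is the convex conical hull of $A$, i.e. all finite combinations of elements of $A$ with nonnegative coefficients. $x_i\xrightarrow[f]{\Omega}\bar x$ means $x_i\in\Omega$, $x_i\to\bar x$ and $f(x_i)\to f(\bar x)$. In each set of limits of gradients, one considers all such sequences for which $f$ is differentiable at every $x_i$ and the indicated limit exists. Normal cones: for $Q\subset\mathbf{R}^n$ and $x\in Q$, the Fréchet normal cone $\hat N_Q(x)$ is the set of $v$ with $\langle v,y-x\rangle\le o(|y-x|)$ as $y\to x$ in $Q$; the limiting normal cone $N_Q(x)$ is the set of all limits $\lim v_i$ with $v_i\in\hat N_Q(x_i)$, $x_i\to x$, $x_i\in Q$; the Clarke normal cone is $N^c_Q(x)=\operatorname{cl}\operatorname{conv}N_Q(x)$. Subdifferentials (at $x$ with $f(x)$ finite): $\partial_c f(x)=\{v:(v,-1)\in N^c_{\operatorname{epi} f}(x,f(x))\}$ and the horizon subdifferential is $\partial^\infty f(x)=\{v:(v,0)\in N_{\operatorname{epi} f}(x,f(x))\}$. Directionally Lipschitzian: $f$ is directionally Lipschitzian at $x$ (with $f(x)$ finite)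 if $f$ is locally lower semicontinuous at $x$ (equivalently, $\operatorname{epi} f$ is locally closed at $(x,f(x))$) and the cone $\partial^\infty f(x)$ is pointed, where a cone $K$ is pointed if no finite family of vectors in $K$, not all zero, sums to $0$. Equivalently: $\operatorname{epi} f$ is locally closed at $(x,f(x))$ and $N^c_{\operatorname{epi} f}(x,f(x))$ contains no line. Vertical continuity: $f$ is vertically continuous at $\bar y\in\operatorname{dom} f$ if $$\operatorname*{Limsup}_{\substack{x\to\bar y,\ r\to f(\bar y)\\ r>f(x)}}N_{\operatorname{epi} f}(x,r)=N_{\operatorname{dom} f}(\bar y)\times\{0\},$$ where the left side is the set of all limits of sequences $v_i\in N_{\operatorname{epi} f}(x_i,r_i)$ with $x_i\to\bar y$, $r_i\to f(\bar y)$, $r_i>f(x_i)$. Stratifiable: a locally finite stratification of a set $Q\subset\mathbf{R}^n$ is a partition of $Q$ into disjoint ($\mathbf{C}^2$-)submanifolds $M_i$ of $\mathbf{R}^n$ (strata) such that the closure of each $M_i$ in $Q$ is a union of some of the $M_j$, and each point of $Q$ has a neighborhood meeting only finitely many strata. $f$ is stratifiable if $\operatorname{dom} f$ has a locally finite stratification such that $f$ is $\mathbf{C}^2$-smooth on each stratum, i.e. near each point of the stratum $f$ agrees on the stratum with a $\mathbf{C}^2$ function on $\mathbf{R}^n$. *)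

theory Defs
  imports "HOL-Analysis.Analysis" "HOL-Library.Landau_Symbols" "HOL-Library.Disjoint_Sets"
begin

definition proper_fun :: "('a \<Rightarrow> ereal) \<Rightarrow> bool" where
  "proper_fun f \<longleftrightarrow> (\<forall>x. f x \<noteq> -\<infinity>) \<and> (\<exists>x. f x \<noteq> \<infinity>)"

definition edom :: "('a \<Rightarrow> ereal) \<Rightarrow> 'a set" where
  "edom f = {x. f x < \<infinity>}"

definition epi :: "('a \<Rightarrow> ereal) \<Rightarrow> ('a \<times> real) set" where
  "epi f = {(x, r). f x \<le> ereal r}"

text \<open>Differentiability at \<open>x\<close> includes finiteness of \<open>f\<close> in a neighborhood of \<open>x\<close>; without it,
  \<^const>\<open>real_of_ereal\<close> would silently replace infinite values by 0.\<close>

definition has_egradient :: "('a::real_inner \<Rightarrow> ereal) \<Rightarrow> 'a \<Rightarrow> 'a \<Rightarrow> bool" where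
  "has_egradient f x v \<longleftrightarrow>
     (\<forall>\<^sub>F y in nhds x. \<bar>f y\<bar> \<noteq> \<infinity>) \<and> (GDERIV (\<lambda>y. real_of_ereal (f y)) x :> v)"

text \<open>These cones are meant for base points \<open>x \<in> Q\<close> only.\<close>

definition frechet_normal_cone :: "'a::real_inner set \<Rightarrow> 'a \<Rightarrow> 'a set" where
  "frechet_normal_cone Q x =
     {v. \<exists>\<rho>::'a \<Rightarrow> real. \<rho> \<in> o[at x within Q](\<lambda>y. norm (y - x)) \<and>
           (\<forall>\<^sub>F y in at x within Q. v \<bullet> (y - x) \<le> \<rho> y)}"

definition limiting_normal_cone :: "'a::real_inner set \<Rightarrow> 'a \<Rightarrow> 'a set" where
  "limiting_normal_cone Q x =
     {v. \<exists>X V. (\<forall>i::nat. X i \<in> Q \<and> V i \<in> frechet_normal_cone Q (X i)) \<and>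
           X \<longlonglongrightarrow> x \<and> V \<longlonglongrightarrow> v}"

definition clarke_normal_cone :: "'a::real_inner set \<Rightarrow> 'a \<Rightarrow> 'a set" where
  "clarke_normal_cone Q x = closure (convex hull (limiting_normal_cone Q x))"

lemma frechet_normal_cone_iff:
  "v \<in> frechet_normal_cone Q x \<longleftrightarrow>
     (\<forall>e>0. \<forall>\<^sub>F y in at x within Q. v \<bullet> (y - x) \<le> e * norm (y - x))"
proof
  assume "v \<in> frechet_normal_cone Q x"
  then obtain \<rho> :: "'a \<Rightarrow> real" where \<rho>: "\<rho> \<in> o[at x within Q](\<lambda>y. norm (y - x))"
    and le: "\<forall>\<^sub>F y in at x within Q. v \<bullet> (y - x) \<le> \<rho> y"
    unfolding frechet_normal_cone_def by blast
  show "\<forall>e>0. \<forall>\<^sub>F y in at x within Q. v \<bullet> (y - x) \<le> e * norm (y - x)"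
  proof (intro allI impI)
    fix e :: real assume "e > 0"
    from landau_o.smallD[OF \<rho> this] le
    show "\<forall>\<^sub>F y in at x within Q. v \<bullet> (y - x) \<le> e * norm (y - x)"
      by eventually_elim auto
  qed
next
  assume R: "\<forall>e>0. \<forall>\<^sub>F y in at x within Q. v \<bullet> (y - x) \<le> e * norm (y - x)"
  define \<rho> where "\<rho> = (\<lambda>y. max 0 (v \<bullet> (y - x)))"
  have "\<rho> \<in> o[at x within Q](\<lambda>y. norm (y - x))"
  proof (rule landau_o.smallI)
    fix e :: real assume "e > 0"
    with R have "\<forall>\<^sub>F y in at x within Q. v \<bullet> (y - x) \<le> e * norm (y - x)" by blast
    then show "\<forall>\<^sub>F y in at x within Q. norm (\<rho> y) \<le> e * norm (norm (y - x))"
      by eventually_elim (use \<open>e > 0\<close> in \<open>auto simp: \<rho>_def\<close>)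
  qed
  then show "v \<in> frechet_normal_cone Q x"
    unfolding frechet_normal_cone_def \<rho>_def by (auto intro!: exI[of _ \<rho>] simp: \<rho>_def)
qed

definition clarke_subdiff :: "('a::real_inner \<Rightarrow> ereal) \<Rightarrow> 'a \<Rightarrow> 'a set" where
  "clarke_subdiff f x = {v. (v, -1) \<in> clarke_normal_cone (epi f) (x, real_of_ereal (f x))}"

definition horizon_subdiff :: "('a::real_inner \<Rightarrow> ereal) \<Rightarrow> 'a \<Rightarrow> 'a set" where
  "horizon_subdiff f x = {v. (v, 0) \<in> limiting_normal_cone (epi f) (x, real_of_ereal (f x))}"

definition pointed_cone :: "'a::real_vector set \<Rightarrow> bool" where
  "pointed_cone K \<longleftrightarrow>
     (\<forall>(m::nat) v. (\<forall>i<m. v i \<in> K) \<and> (\<Sum>i<m. v i) = 0 \<longrightarrow> (\<forall>i<m. v i = 0))"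

definition locally_closed_at :: "'a::metric_space set \<Rightarrow> 'a \<Rightarrow> bool" where
  "locally_closed_at Q x \<longleftrightarrow> (\<exists>e>0. closed (Q \<inter> cball x e))"

text \<open>Local lower semicontinuity of \<open>f\<close> at \<open>x\<close> is rendered as local closedness of the epigraph.\<close>

definition directionally_lipschitzian :: "('a::real_inner \<Rightarrow> ereal) \<Rightarrow> 'a \<Rightarrow> bool" where
  "directionally_lipschitzian f x \<longleftrightarrow>
     \<bar>f x\<bar> \<noteq> \<infinity> \<and> locally_closed_at (epi f) (x, real_of_ereal (f x)) \<and>
     pointed_cone (horizon_subdiff f x)"

definition vertically_continuous :: "('a::real_inner \<Rightarrow> ereal) \<Rightarrow> 'a \<Rightarrow> bool" where
  "vertically_continuous f y \<longleftrightarrow>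
     y \<in> edom f \<and>
     {w. \<exists>X R W. (\<forall>i::nat. f (X i) < ereal (R i) \<and> W i \<in> limiting_normal_cone (epi f) (X i, R i)) \<and>
           X \<longlonglongrightarrow> y \<and> (\<lambda>i. ereal (R i)) \<longlonglongrightarrow> f y \<and> W \<longlonglongrightarrow> w}
     = limiting_normal_cone (edom f) y \<times> {0}"

definition C2_on :: "('a::real_normed_vector \<Rightarrow> 'b::real_normed_vector) \<Rightarrow> 'a set \<Rightarrow> bool" where
  "C2_on g U \<longleftrightarrow>
     open U \<and>
     (\<exists>(g' :: 'a \<Rightarrow> 'a \<Rightarrow>\<^sub>L 'b) (g'' :: 'a \<Rightarrow> 'a \<Rightarrow>\<^sub>L ('a \<Rightarrow>\<^sub>L 'b)).
        (\<forall>x\<in>U. (g has_derivative blinfun_apply (g' x)) (at x) \<and>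
               (g' has_derivative blinfun_apply (g'' x)) (at x)) \<and>
        continuous_on U g'')"

text \<open>Embedded submanifolds, via \<open>C\<^sup>2\<close> charts of the ambient space that flatten \<open>M\<close> onto a
  linear subspace of a fixed dimension.\<close>

definition C2_submanifold :: "'a::euclidean_space set \<Rightarrow> bool" where
  "C2_submanifold M \<longleftrightarrow>
     (\<exists>k. \<forall>x\<in>M. \<exists>U V \<phi> \<psi> (L :: 'a set).
        x \<in> U \<and> C2_on \<phi> U \<and> C2_on \<psi> V \<and> homeomorphism U V \<phi> \<psi> \<and>
        subspace L \<and> dim L = k \<and> \<phi> ` (M \<inter> U) = L \<inter> V)"

definition locally_finite_stratification :: "'a::euclidean_space set \<Rightarrow> 'a set set \<Rightarrow> bool" where
  "locally_finite_stratification Q \<M> \<longleftrightarrow>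
     partition_on Q \<M> \<and>
     (\<forall>M\<in>\<M>. C2_submanifold M) \<and>
     (\<forall>M\<in>\<M>. \<exists>\<N>\<subseteq>\<M>. Q \<inter> closure M = \<Union>\<N>) \<and>
     (\<forall>x\<in>Q. \<exists>U. open U \<and> x \<in> U \<and> finite {M\<in>\<M>. M \<inter> U \<noteq> {}})"

definition C2_smooth_on_stratum :: "('a::euclidean_space \<Rightarrow> ereal) \<Rightarrow> 'a set \<Rightarrow> bool" where
  "C2_smooth_on_stratum f M \<longleftrightarrow>
     (\<forall>x\<in>M. \<exists>U (g :: 'a \<Rightarrow> real). open U \<and> x \<in> U \<and> C2_on g UNIV \<and> (\<forall>y\<in>M \<inter> U. f y = ereal (g y)))"

definition stratifiable :: "('a::euclidean_space \<Rightarrow> ereal) \<Rightarrow> bool" where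
  "stratifiable f \<longleftrightarrow>
     (\<exists>\<M>. locally_finite_stratification (edom f) \<M> \<and> (\<forall>M\<in>\<M>. C2_smooth_on_stratum f M))"

definition grad_seq ::
    "('a::real_inner \<Rightarrow> ereal) \<Rightarrow> 'a set \<Rightarrow> 'a \<Rightarrow> (nat \<Rightarrow> 'a) \<Rightarrow> (nat \<Rightarrow> 'a) \<Rightarrow> bool" where
  "grad_seq f \<Omega> x X G \<longleftrightarrow>
     (\<forall>i. X i \<in> \<Omega> \<and> has_egradient f (X i) (G i)) \<and>
     X \<longlonglongrightarrow> x \<and> (\<lambda>i. f (X i)) \<longlonglongrightarrow> f x"

definition limit_unit_normals :: "('a::real_inner \<Rightarrow> ereal) \<Rightarrow> 'a set \<Rightarrow> 'a \<Rightarrow> ('a \<times> real) set" where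
  "limit_unit_normals f \<Omega> x =
     {w. \<exists>X G. grad_seq f \<Omega> x X G \<and>
           (\<lambda>i. (1 / sqrt (1 + (norm (G i))\<^sup>2)) *\<^sub>R (G i, -1)) \<longlonglongrightarrow> w}"

definition limit_gradients :: "('a::real_inner \<Rightarrow> ereal) \<Rightarrow> 'a set \<Rightarrow> 'a \<Rightarrow> 'a set" where
  "limit_gradients f \<Omega> x = {v. \<exists>X G. grad_seq f \<Omega> x X G \<and> G \<longlonglongrightarrow> v}"

text \<open>As usual in variational analysis, \<open>t\<^sub>i \<down> 0\<close> means \<open>t\<^sub>i \<rightarrow> 0\<close> with \<open>t\<^sub>i > 0\<close>.\<close>

definition limit_scaled_gradients :: "('a::real_inner \<Rightarrow> ereal) \<Rightarrow> 'a set \<Rightarrow> 'a \<Rightarrow> 'a set" where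
  "limit_scaled_gradients f \<Omega> x =
     {v. \<exists>X G t. grad_seq f \<Omega> x X G \<and> (\<forall>i. (0::real) < t i) \<and> t \<longlonglongrightarrow> 0 \<and>
           (\<lambda>i. t i *\<^sub>R G i) \<longlonglongrightarrow> v}"

text \<open>The convex conical hull is the library's \<^term>\<open>convex_cone hull A\<close>: it consists of all finite
  nonnegative combinations, including the empty one.\<close>

lemma convex_cone_hull_combinations:
  "convex_cone hull A = {\<Sum>a\<in>F. c a *\<^sub>R a | F c. finite F \<and> F \<subseteq> A \<and> (\<forall>a\<in>F. (0::real) \<le> c a)}"
  (is "_ = ?C")
proof
  have C_I: "(\<Sum>a\<in>F. c a *\<^sub>R a) \<in> ?C" if "finite F" "F \<subseteq> A" "\<forall>a\<in>F. (0::real) \<le> c a" for F c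
    using that by blast
  have "convex_cone ?C"
    unfolding convex_cone_iff
  proof (intro conjI ballI allI impI)
    show "0 \<in> ?C" using C_I[of "{}" "\<lambda>_. 0"] by simp
  next
    fix x y assume "x \<in> ?C" "y \<in> ?C"
    then obtain F c G d where F: "finite F" "F \<subseteq> A" "\<forall>a\<in>F. (0::real) \<le> c a" "x = (\<Sum>a\<in>F. c a *\<^sub>R a)"
      and G: "finite G" "G \<subseteq> A" "\<forall>a\<in>G. (0::real) \<le> d a" "y = (\<Sum>a\<in>G. d a *\<^sub>R a)" by blast
    define e where "e a = (if a \<in> F then c a else 0) + (if a \<in> G then d a else 0)" for a
    have "x = (\<Sum>a\<in>F\<union>G. (if a \<in> F then c a else 0) *\<^sub>R a)"
      unfolding F(4) using F(1) G(1) by (intro sum.mono_neutral_cong_left) auto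
    moreover have "y = (\<Sum>a\<in>F\<union>G. (if a \<in> G then d a else 0) *\<^sub>R a)"
      unfolding G(4) using F(1) G(1) by (intro sum.mono_neutral_cong_left) auto
    ultimately have "x + y = (\<Sum>a\<in>F\<union>G. e a *\<^sub>R a)"
      unfolding e_def by (simp add: scaleR_add_left sum.distrib)
    moreover have "(\<Sum>a\<in>F\<union>G. e a *\<^sub>R a) \<in> ?C"
      by (rule C_I) (use F G in \<open>auto simp: e_def\<close>)
    ultimately show "x + y \<in> ?C" by simp
  next
    fix x and k :: real assume "x \<in> ?C" "0 \<le> k"
    then obtain F c where F: "finite F" "F \<subseteq> A" "\<forall>a\<in>F. (0::real) \<le> c a" "x = (\<Sum>a\<in>F. c a *\<^sub>R a)"
      by blast
    have "(\<Sum>a\<in>F. (k * c a) *\<^sub>R a) \<in> ?C"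
      by (rule C_I) (use F \<open>0 \<le> k\<close> in auto)
    then show "k *\<^sub>R x \<in> ?C" using F(4) by (simp add: scaleR_sum_right)
  qed
  moreover have "A \<subseteq> ?C"
  proof
    fix a assume "a \<in> A"
    then show "a \<in> ?C" using C_I[of "{a}" "\<lambda>_. 1"] by simp
  qed
  ultimately show "convex_cone hull A \<subseteq> ?C" by (rule hull_minimal[rotated])
next
  show "?C \<subseteq> convex_cone hull A"
  proof
    fix x assume "x \<in> ?C"
    then obtain F c where F: "finite F" "F \<subseteq> A" "\<forall>a\<in>F. (0::real) \<le> c a" "x = (\<Sum>a\<in>F. c a *\<^sub>R a)"
      by blast
    from F(1-3) have "(\<Sum>a\<in>F. c a *\<^sub>R a) \<in> convex_cone hull A"
      by (induction F rule: finite_induct)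
         (simp_all add: convex_cone_hull_contains_0 convex_cone_hull_add convex_cone_hull_mul hull_inc)
    then show "x \<in> convex_cone hull A" using F(4) by simp
  qed
qed

end

theory Submission
  imports Defs
begin

text \<open>Let \<open>K(x)\<close> be the convex cone generated by the limits of normals \<open>c (\<nabla>f, -1)\<close> at \<open>x\<close> and by
  \<open>N\<^bsub>dom f\<^esub>(x) \<times> {0}\<close>. Pointedness makes \<open>x \<mapsto> K(x)\<close> outer semicontinuous, so it suffices to find every
  Frechet normal \<open>v\<close> of \<open>epi f\<close> at a graph point over \<open>x\<close> in \<open>K(x)\<close>. On an open stratum \<open>v\<close> is a
  multiple of \<open>(\<nabla>f, -1)\<close>. On a stratum \<open>M\<close> of smaller dimension the Frechet cone is pointed and
  lies in the normal space of the graph of \<open>f|M\<close>, which has dimension at least two; hence \<open>v\<close> is a sum of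
  vectors in the boundary of the cone relative to that space. Such boundary vectors are limits of
  normals at nearby points off the graph of \<open>f|M\<close>: either points above the graph of \<open>f\<close>, where vertical
  continuity applies, or graph points over other strata, which are handled by induction on the
  number of strata adherent to the base point.\<close>

section \<open>Normal cones\<close>

text \<open>Pointedness is assumed of the horizon normals only. Vertical continuity extends it: it
  exhibits the normals to \<open>dom f\<close>, placed at height 0, as limits of normals to the
  epigraph, so that all generators of \<open>K(x)\<close> lie in one pointed cone. Hence
  \<open>K(x)\<close> is closed, which absorbs the closure in the Clarke cone.

  The normal space of the graph of \<open>f|M\<close> contains a horizontal vector
  \<open>(e, 0)\<close>, with \<open>e\<close> normal to \<open>M\<close>, and the upward normal
  \<open>(-grad, 1)\<close>. Normals to an epigraph never point upwards, so tilting a horizontal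
  normal by the latter leaves the cone: horizontal normals are boundary vectors. Since
  \<open>(e, 0)\<close> and its opposite are not both normals, these two directions suffice to split
  every normal into boundary vectors.

  A boundary vector is reached by projecting onto the epigraph, and the projection must miss the
  graph of \<open>f|M\<close>. First-order orthogonality is too weak for that; C2 smoothness makes
  the normal space consist of proximal normals, with a quadratic bound. Submanifolds are locally
  closed, so \<open>M\<close> is no longer adherent to points near \<open>x\<close> off
  \<open>M\<close>; this drives the induction.\<close>

lemma frechet_normal_cone_dist:
  "v \<in> frechet_normal_cone Q x \<longleftrightarrow>
     (\<forall>e>0. \<exists>d>0. \<forall>y\<in>Q. dist y x < d \<longrightarrow> v \<bullet> (y - x) \<le> e * norm (y - x))"
  unfolding frechet_normal_cone_iff eventually_at
  by (metis diff_self inner_zero_right mult_zero_right norm_zero order_refl)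

lemma convex_cone_frechet_normal_cone: "convex_cone (frechet_normal_cone Q x)"
  unfolding convex_cone_iff
proof (intro conjI ballI allI impI)
  show "0 \<in> frechet_normal_cone Q x"
    by (auto simp: frechet_normal_cone_iff)
next
  fix v w assume v: "v \<in> frechet_normal_cone Q x" and w: "w \<in> frechet_normal_cone Q x"
  show "v + w \<in> frechet_normal_cone Q x"
    unfolding frechet_normal_cone_iff
  proof (intro allI impI)
    fix e :: real assume "e > 0"
    then have "e / 2 > 0" by simp
    with v have 1: "\<forall>\<^sub>F y in at x within Q. v \<bullet> (y - x) \<le> e / 2 * norm (y - x)"
      unfolding frechet_normal_cone_iff by blast
    from \<open>e / 2 > 0\<close> w have 2: "\<forall>\<^sub>F y in at x within Q. w \<bullet> (y - x) \<le> e / 2 * norm (y - x)"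
      unfolding frechet_normal_cone_iff by blast
    from 1 2 show "\<forall>\<^sub>F y in at x within Q. (v + w) \<bullet> (y - x) \<le> e * norm (y - x)"
      by eventually_elim (simp add: inner_add_left)
  qed
next
  fix v and c :: real assume v: "v \<in> frechet_normal_cone Q x" and "0 \<le> c"
  show "c *\<^sub>R v \<in> frechet_normal_cone Q x"
  proof (cases "c = 0")
    case True
    then show ?thesis by (auto simp: frechet_normal_cone_iff)
  next
    case False
    with \<open>0 \<le> c\<close> have "c > 0" by simp
    show ?thesis
      unfolding frechet_normal_cone_iff
    proof (intro allI impI)
      fix e :: real assume "e > 0"
      then have "e / c > 0" using \<open>c > 0\<close> by simp
      with v have "\<forall>\<^sub>F y in at x within Q. v \<bullet> (y - x) \<le> e / c * norm (y - x)"
        unfolding frechet_normal_cone_iff by blast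
      then show "\<forall>\<^sub>F y in at x within Q. (c *\<^sub>R v) \<bullet> (y - x) \<le> e * norm (y - x)"
        by eventually_elim (use \<open>c > 0\<close> in \<open>simp add: field_simps\<close>)
    qed
  qed
qed

lemma closed_frechet_normal_cone: "closed (frechet_normal_cone Q x)"
  unfolding closure_subset_eq[symmetric]
proof
  fix v assume "v \<in> closure (frechet_normal_cone Q x)"
  then have v: "\<forall>e>0. \<exists>w\<in>frechet_normal_cone Q x. dist w v < e"
    by (simp add: closure_approachable)
  show "v \<in> frechet_normal_cone Q x"
    unfolding frechet_normal_cone_iff
  proof (intro allI impI)
    fix e :: real assume "e > 0"
    then have "e / 2 > 0" by simp
    with v obtain w where w: "w \<in> frechet_normal_cone Q x" and wv: "dist w v < e / 2" by blast
    from w \<open>e / 2 > 0\<close> have "\<forall>\<^sub>F y in at x within Q. w \<bullet> (y - x) \<le> e / 2 * norm (y - x)"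
      unfolding frechet_normal_cone_iff by blast
    then show "\<forall>\<^sub>F y in at x within Q. v \<bullet> (y - x) \<le> e * norm (y - x)"
    proof eventually_elim
      case (elim y)
      have "(v - w) \<bullet> (y - x) \<le> norm (v - w) * norm (y - x)" by (rule norm_cauchy_schwarz)
      also have "\<dots> \<le> e / 2 * norm (y - x)"
        using wv by (intro mult_right_mono) (auto simp: dist_norm norm_minus_commute)
      finally show ?case using elim by (simp add: inner_diff_left)
    qed
  qed
qed

text \<open>Taking the closure of the whole graph of the Frechet cone turns closedness and outer
  semicontinuity of the limiting cone into idempotence of closure; no diagonal sequences have to be
  built.\<close>

lemma limiting_normal_cone_closure:
  "limiting_normal_cone Q x = {v. (x, v) \<in> closure {(y, w). y \<in> Q \<and> w \<in> frechet_normal_cone Q y}}"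
  (is "_ = {v. _ \<in> closure ?A}")
proof (intro set_eqI iffI)
  fix v assume "v \<in> limiting_normal_cone Q x"
  then obtain X V where XV: "\<And>i::nat. X i \<in> Q \<and> V i \<in> frechet_normal_cone Q (X i)"
    "X \<longlonglongrightarrow> x" "V \<longlonglongrightarrow> v" unfolding limiting_normal_cone_def by blast
  then have "(\<lambda>i. (X i, V i)) \<longlonglongrightarrow> (x, v)" by (intro tendsto_Pair)
  with XV(1) show "v \<in> {v. (x, v) \<in> closure ?A}"
    unfolding closure_sequential by (auto intro!: exI[of _ "\<lambda>i. (X i, V i)"])
next
  fix v assume "v \<in> {v. (x, v) \<in> closure ?A}"
  then obtain P where P: "\<And>i::nat. P i \<in> ?A" "P \<longlonglongrightarrow> (x, v)"
    unfolding closure_sequential by auto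
  have "(\<lambda>i. fst (P i)) \<longlonglongrightarrow> x" "(\<lambda>i. snd (P i)) \<longlonglongrightarrow> v"
    using tendsto_fst[OF P(2)] tendsto_snd[OF P(2)] by simp_all
  moreover have "\<forall>i. fst (P i) \<in> Q \<and> snd (P i) \<in> frechet_normal_cone Q (fst (P i))"
    using P(1) by (simp add: case_prod_beta)
  ultimately show "v \<in> limiting_normal_cone Q x"
    unfolding limiting_normal_cone_def mem_Collect_eq by (intro exI conjI)
qed

lemma frechet_subset_limiting_normal_cone:
  "x \<in> Q \<Longrightarrow> frechet_normal_cone Q x \<subseteq> limiting_normal_cone Q x"
  unfolding limiting_normal_cone_closure using closure_subset by fastforce

lemma closed_section: "closed A \<Longrightarrow> closed {v. (x, v) \<in> A}"
  for A :: "('a::topological_space \<times> 'b::topological_space) set"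
  using closed_vimage[of A "\<lambda>v. (x, v)"] by (simp add: vimage_def continuous_on_Pair)

lemma closed_limiting_normal_cone: "closed (limiting_normal_cone Q x)"
  unfolding limiting_normal_cone_closure by (rule closed_section) simp

lemma limiting_normal_cone_osc:
  assumes "X \<longlonglongrightarrow> x" "V \<longlonglongrightarrow> v" "\<And>i::nat. V i \<in> limiting_normal_cone Q (X i)"
  shows "v \<in> limiting_normal_cone Q x"
proof -
  let ?A = "{(y, w). y \<in> Q \<and> w \<in> frechet_normal_cone Q y}"
  have "(\<lambda>i. (X i, V i)) \<longlonglongrightarrow> (x, v)" using assms by (intro tendsto_Pair)
  moreover have "\<forall>i. (X i, V i) \<in> closure ?A"
    using assms(3) unfolding limiting_normal_cone_closure by blast
  ultimately have "(x, v) \<in> closure (closure ?A)"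
    unfolding closure_sequential[of _ "closure ?A"] by (intro exI conjI)
  then show ?thesis by (simp add: limiting_normal_cone_closure)
qed

lemma limiting_normal_cone_scaleR:
  assumes "v \<in> limiting_normal_cone Q x" "0 \<le> c"
  shows "c *\<^sub>R v \<in> limiting_normal_cone Q x"
proof -
  obtain X V where XV: "\<And>i::nat. X i \<in> Q \<and> V i \<in> frechet_normal_cone Q (X i)"
    "X \<longlonglongrightarrow> x" "V \<longlonglongrightarrow> v" using assms(1) unfolding limiting_normal_cone_def by blast
  have "(\<lambda>i. c *\<^sub>R V i) \<longlonglongrightarrow> c *\<^sub>R v" using XV(3) by (intro tendsto_intros)
  moreover have "\<And>i. X i \<in> Q \<and> c *\<^sub>R V i \<in> frechet_normal_cone Q (X i)"
    using XV(1) assms(2) convex_cone_frechet_normal_cone convex_cone_scaleR by blast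
  ultimately show ?thesis
    unfolding limiting_normal_cone_def mem_Collect_eq using XV(2)
    by (intro exI[of _ X] exI[of _ "\<lambda>i. c *\<^sub>R V i"]) auto
qed

lemma zero_in_limiting_normal_cone: "x \<in> Q \<Longrightarrow> 0 \<in> limiting_normal_cone Q x"
  using frechet_subset_limiting_normal_cone convex_cone_contains_0[OF convex_cone_frechet_normal_cone]
  by blast

lemma convex_cone_clarke_normal_cone:
  fixes Q :: "'a::euclidean_space set"
  assumes "x \<in> Q"
  shows "convex_cone (clarke_normal_cone Q x)"
proof -
  let ?N = "limiting_normal_cone Q x"
  have "cone ?N" using limiting_normal_cone_scaleR[of _ Q x] by (auto simp: cone_def)
  then have "cone (closure (convex hull ?N))"
    by (intro cone_closure cone_convex_hull)
  then have "conic (closure (convex hull ?N))" by (auto simp: cone_def conic_def)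
  moreover have "closure (convex hull ?N) \<noteq> {}"
    using zero_in_limiting_normal_cone[OF assms] by auto
  ultimately show ?thesis
    unfolding clarke_normal_cone_def convex_cone_def by (auto intro: convex_closure)
qed

section \<open>Outer semicontinuity of convex conical hulls\<close>

text \<open>The unit vectors of \<open>G\<close> form a compact base whose convex hull is compact
  and, by pointedness, misses 0; the cone over such a set is closed. For closed cones that are not
  pointed the hull can fail to be closed.\<close>

lemma closed_convex_cone_hull_cone:
  fixes G :: "'a::euclidean_space set"
  assumes "closed G" and cone: "\<And>g c. g \<in> G \<Longrightarrow> 0 \<le> c \<Longrightarrow> c *\<^sub>R g \<in> G"
    and pointed: "0 \<notin> convex hull (G \<inter> sphere 0 1)"
  shows "closed (convex_cone hull G)"
proof -
  let ?B = "G \<inter> sphere 0 1"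
  have "compact (convex hull ?B)"
    by (intro compact_convex_hull closed_Int_compact assms compact_sphere)
  then have "closed (conic hull (convex hull ?B))"
    using closed_conic_hull pointed by blast
  then have "closed (insert 0 (conic hull (convex hull ?B)))" by simp
  moreover have "convex_cone hull G = convex_cone hull ?B"
  proof
    show "convex_cone hull G \<subseteq> convex_cone hull ?B"
    proof (rule hull_minimal)
      show "G \<subseteq> convex_cone hull ?B"
      proof
        fix g assume g: "g \<in> G"
        show "g \<in> convex_cone hull ?B"
        proof (cases "g = 0")
          case False
          then have "(1 / norm g) *\<^sub>R g \<in> ?B" using g cone[of g "1 / norm g"] by simp
          then have "norm g *\<^sub>R (1 / norm g) *\<^sub>R g \<in> convex_cone hull ?B"
            by (intro convex_cone_hull_mul hull_inc) auto
          with False show ?thesis by simp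
        qed (simp add: convex_cone_hull_contains_0)
      qed
    qed (rule convex_cone_convex_cone_hull)
    show "convex_cone hull ?B \<subseteq> convex_cone hull G" by (rule hull_mono) simp
  qed
  moreover have "convex_cone hull ?B = insert 0 (conic hull (convex hull ?B))"
    by (rule convex_cone_hull_separate)
  ultimately show ?thesis by metis
qed

text \<open>Separation of \<open>l\<close> from the closed hull, tilted by a functional that is strictly negative on
  \<open>G - {0}\<close>, reduces the claim to outer semicontinuity of \<open>S\<close> itself, so that no control of the
  summands of \<open>W i\<close> is needed.\<close>

lemma convex_cone_hull_osc:
  fixes G :: "'a::euclidean_space set" and S :: "nat \<Rightarrow> 'a set"
  assumes "closed G" and cone: "\<And>g c. g \<in> G \<Longrightarrow> 0 \<le> c \<Longrightarrow> c *\<^sub>R g \<in> G"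
    and pointed: "0 \<notin> convex hull (G \<inter> sphere 0 1)"
    and coneS: "\<And>i g c. g \<in> S i \<Longrightarrow> 0 \<le> c \<Longrightarrow> c *\<^sub>R g \<in> S i"
    and osc: "\<And>r g l. strict_mono r \<Longrightarrow> (\<And>i. g i \<in> S (r i)) \<Longrightarrow> g \<longlonglongrightarrow> l \<Longrightarrow> l \<in> G"
    and W: "\<And>i. W i \<in> convex_cone hull (S i)" "W \<longlonglongrightarrow> l"
  shows "l \<in> convex_cone hull G"
proof (rule ccontr)
  assume notin: "l \<notin> convex_cone hull G"
  have "closed (convex_cone hull G)" "convex (convex_cone hull G)"
    using closed_convex_cone_hull_cone[OF assms(1-3)] convex_cone_convex_cone_hull
    by (auto simp: convex_cone_def)
  from separating_hyperplane_closed_point[OF this(2,1) notin] obtain a0 b where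
    b: "a0 \<bullet> l < b" "\<And>x. x \<in> convex_cone hull G \<Longrightarrow> b < a0 \<bullet> x" by blast
  define a where "a = - a0"
  from b(2)[OF convex_cone_hull_contains_0] have "b < 0" by simp
  have al: "a \<bullet> l > 0" using b(1) \<open>b < 0\<close> by (simp add: a_def)
  have aG: "a \<bullet> g \<le> 0" if g: "g \<in> G" for g
  proof (rule ccontr)
    assume "\<not> a \<bullet> g \<le> 0"
    then have n: "a0 \<bullet> g < 0" by (simp add: a_def)
    then have "0 \<le> b / (a0 \<bullet> g)" using \<open>b < 0\<close> by (simp add: divide_nonpos_neg)
    from b(2)[OF convex_cone_hull_mul[OF hull_inc[OF g] this]] n show False by simp
  qed
  let ?B = "G \<inter> sphere 0 1"
  have "compact (convex hull ?B)"
    by (intro compact_convex_hull closed_Int_compact assms compact_sphere)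
  from separating_hyperplane_closed_point[OF convex_convex_hull compact_imp_closed[OF this] pointed]
  obtain c0 d where c0: "0 < d" "\<And>x. x \<in> ?B \<Longrightarrow> d < c0 \<bullet> x"
    using hull_inc[of _ ?B convex] by (metis inner_zero_right)
  \<comment> \<open>Small enough that the tilt by \<open>c0\<close> costs less than half of
    \<open>a \<bullet> l\<close>, so \<open>u\<close> stays positive at \<open>l\<close>; the
    summand 1 keeps the denominator positive.\<close>
  define eta where "eta = a \<bullet> l / (2 * (norm c0 * norm l + 1))"
  have "norm c0 * norm l + 1 > 0" by (simp add: add_nonneg_pos)
  then have eta: "eta > 0" using al by (simp add: eta_def)
  define u where "u = a - eta *\<^sub>R c0"
  have "c0 \<bullet> l < norm c0 * norm l + 1" using norm_cauchy_schwarz[of c0 l] by simp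
  then have "eta * (c0 \<bullet> l) < eta * (norm c0 * norm l + 1)" using eta by simp
  also have "\<dots> = a \<bullet> l / 2" using \<open>norm c0 * norm l + 1 > 0\<close> by (simp add: eta_def field_simps)
  finally have ul: "u \<bullet> l > 0" using al by (simp add: u_def inner_diff_left)
  have uB: "u \<bullet> g < 0" if "g \<in> ?B" for g
  proof -
    have "eta * (c0 \<bullet> g) > 0" using c0(2)[OF that] c0(1) eta by simp
    then show ?thesis using aG[of g] that by (simp add: u_def inner_diff_left)
  qed
  have "\<forall>\<^sub>F i in sequentially. \<forall>g\<in>S i. u \<bullet> g \<le> 0"
  proof (rule ccontr)
    assume "\<not> ?thesis"
    then have inf: "infinite {i. \<exists>g\<in>S i. u \<bullet> g > 0}"
      by (auto simp: not_eventually frequently_sequentially infinite_nat_iff_unbounded_le not_le)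
    define r where "r = enumerate {i. \<exists>g\<in>S i. u \<bullet> g > 0}"
    have r: "strict_mono r" and "\<And>i. \<exists>g\<in>S (r i). u \<bullet> g > 0"
      unfolding r_def using strict_mono_enumerate[OF inf] enumerate_in_set[OF inf] by auto
    then obtain g where g: "\<And>i. g i \<in> S (r i)" "\<And>i. u \<bullet> g i > 0" by metis
    \<comment> \<open>Normalising makes the sphere's compactness available: a subsequential limit is
      a unit vector of \<open>G\<close> on which \<open>u\<close> is nonnegative, against
      \<open>uB\<close>.\<close>
    define h where "h i = (1 / norm (g i)) *\<^sub>R g i" for i
    have nz: "g i \<noteq> 0" for i using g(2)[of i] by auto
    have h: "h i \<in> S (r i)" "u \<bullet> h i \<ge> 0" "h i \<in> sphere 0 1" for i
      using g[of i] coneS[OF g(1), of "1 / norm (g i)"] nz[of i] by (auto simp: h_def less_imp_le)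
    obtain k s where ks: "k \<in> sphere (0::'a) 1" "strict_mono s" "(h \<circ> s) \<longlonglongrightarrow> k"
      using compact_sphere[of "0::'a" 1] h(3) unfolding compact_def by metis
    have "k \<in> G"
      by (rule osc[of "r \<circ> s" "h \<circ> s"]) (use r ks h(1) in \<open>auto simp: strict_mono_o\<close>)
    then have "u \<bullet> k < 0" using uB ks(1) by auto
    moreover have "0 \<le> u \<bullet> k"
      using tendsto_inner[OF tendsto_const[of u] ks(3)]
      by (rule LIMSEQ_le_const) (use h(2) in auto)
    ultimately show False by simp
  qed
  then have "\<forall>\<^sub>F i in sequentially. u \<bullet> W i \<le> 0"
  proof eventually_elim
    case (elim i)
    have "convex_cone hull (S i) \<subseteq> {x. u \<bullet> x \<le> 0}"
      using elim by (intro hull_minimal convex_cone_halfspace_le) auto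
    with W(1) show ?case by auto
  qed
  with tendsto_inner[OF tendsto_const[of u] W(2)] have "u \<bullet> l \<le> 0"
    by (rule tendsto_upperbound) simp
  with ul show False by simp
qed

section \<open>Accessibility of boundary normals\<close>

lemma norm_diff_shift_sq:
  fixes z :: "'a::real_inner"
  shows "(norm (z + b - y))\<^sup>2 = (norm b)\<^sup>2 - 2 * (b \<bullet> (y - z)) + (norm (y - z))\<^sup>2"
  unfolding power2_norm_eq_inner by (simp add: algebra_simps inner_commute)

text \<open>Expanding the squares in \<open>dist p y \<le> dist p y'\<close> bounds twice the inner
  product by the square of \<open>norm (y' - y)\<close>. Within distance \<open>e\<close> this is at
  most \<open>e * norm (y' - y)\<close>, whence the radius \<open>min r e\<close>.\<close>

lemma proximal_in_frechet_normal_cone: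
  assumes "0 < r" and near: "\<And>y'. y' \<in> Q \<Longrightarrow> dist y' y < r \<Longrightarrow> dist p y \<le> dist p y'"
  shows "p - y \<in> frechet_normal_cone Q y"
  unfolding frechet_normal_cone_dist
proof (intro allI impI)
  fix e :: real assume "e > 0"
  show "\<exists>d>0. \<forall>y'\<in>Q. dist y' y < d \<longrightarrow> (p - y) \<bullet> (y' - y) \<le> e * norm (y' - y)"
  proof (intro exI[of _ "min r e"] conjI ballI impI)
    show "min r e > 0" using \<open>e > 0\<close> \<open>0 < r\<close> by simp
    fix y' assume y': "y' \<in> Q" "dist y' y < min r e"
    with near have "norm (p - y) \<le> norm (p - y')" by (simp add: dist_norm)
    then have "(norm (p - y))\<^sup>2 \<le> (norm (y + (p - y) - y'))\<^sup>2" by (simp add: power_mono)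
    then have "2 * ((p - y) \<bullet> (y' - y)) \<le> norm (y' - y) * norm (y' - y)"
      unfolding norm_diff_shift_sq by (simp add: power2_eq_square)
    also have "\<dots> \<le> e * norm (y' - y)"
      using y'(2) by (intro mult_right_mono) (auto simp: dist_norm)
    finally show "(p - y) \<bullet> (y' - y) \<le> e * norm (y' - y)"
      using mult_nonneg_nonneg[OF less_imp_le[OF \<open>e > 0\<close>] norm_ge_zero[of "y' - y"]] by linarith
  qed
qed

text \<open>Project \<open>z + \<epsilon> b'\<close> onto \<open>Q\<close>: since \<open>b'\<close> is not a normal to \<open>Q\<close> the projection differs
  from \<open>z\<close>, and since \<open>b'\<close> is a proximal normal to \<open>P\<close> it lies off \<open>P\<close>; as \<open>b\<close> is a normal, the
  projection is close to \<open>z\<close> even relative to \<open>\<epsilon>\<close>, so the residual direction is close to \<open>b\<close>.\<close>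

lemma frechet_normal_accessible:
  fixes Q P :: "'a::euclidean_space set"
  assumes lc: "locally_closed_at Q z" and zQ: "z \<in> Q" and b: "b \<in> frechet_normal_cone Q z"
    and bd: "\<And>\<eta>. \<eta> > 0 \<Longrightarrow> \<exists>b'. dist b' b < \<eta> \<and> b' \<notin> frechet_normal_cone Q z \<and>
               (\<exists>C d. d > 0 \<and> (\<forall>y\<in>P. dist y z < d \<longrightarrow> b' \<bullet> (y - z) \<le> C * (norm (y - z))\<^sup>2))"
    and \<eta>: "\<eta> > (0::real)"
  shows "\<exists>y w. y \<in> Q \<and> y \<notin> P \<and> dist y z < \<eta> \<and> w \<in> frechet_normal_cone Q y \<and> dist w b < \<eta>"
proof -
  obtain r where r: "r > 0" "closed (Q \<inter> cball z r)"
    using lc unfolding locally_closed_at_def by blast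
  \<comment> \<open>Error budget: replacing \<open>b\<close> by \<open>b'\<close> and the Frechet
    estimate for \<open>b\<close> cost \<open>\<eta> / 6\<close> each, which bounds
    \<open>norm (y - z) / \<epsilon>\<close> by \<open>2 * \<eta> / 3\<close>. Adding
    \<open>dist b' b\<close> once more gives \<open>5 * \<eta> / 6\<close> in total.\<close>
  from \<eta> have "\<eta> / 6 > 0" by simp
  from bd[OF this] obtain b' C0 d where b': "dist b' b < \<eta> / 6" "b' \<notin> frechet_normal_cone Q z"
    and d: "d > 0" "\<And>y. y \<in> P \<Longrightarrow> dist y z < d \<Longrightarrow> b' \<bullet> (y - z) \<le> C0 * (norm (y - z))\<^sup>2"
    by blast
  define C where "C = max C0 1"
  have C: "C > 0" by (simp add: C_def)
  have dC: "b' \<bullet> (y - z) \<le> C * (norm (y - z))\<^sup>2" if "y \<in> P" "dist y z < d" for y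
    using d(2)[OF that] mult_right_mono[of C0 C "(norm (y - z))\<^sup>2"] by (simp add: C_def)
  from b \<open>\<eta> / 6 > 0\<close> obtain d2 where d2: "d2 > 0"
    "\<And>y. y \<in> Q \<Longrightarrow> dist y z < d2 \<Longrightarrow> b \<bullet> (y - z) \<le> \<eta> / 6 * norm (y - z)"
    unfolding frechet_normal_cone_dist by blast
  define m where "m = min (min d d2) (min \<eta> r)"
  have m: "m > 0" using d d2 \<eta> r by (simp add: m_def)
  \<comment> \<open>The first bound gives \<open>2 * \<epsilon> * norm b' < m\<close>, which keeps
    the projection inside every neighbourhood in use. The second gives
    \<open>2 * \<epsilon> * C < 1\<close>, which makes the quadratic bound on \<open>P\<close>
    incompatible with \<open>lt\<close>.\<close>
  define \<epsilon> where "\<epsilon> = min (m / (4 * (norm b' + 1))) (1 / (4 * C))"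
  have nb: "norm b' + 1 > 0" by (simp add: add_nonneg_pos)
  have \<epsilon>: "\<epsilon> > 0" using m C nb by (simp add: \<epsilon>_def)
  have "\<epsilon> * (4 * (norm b' + 1)) \<le> m / (4 * (norm b' + 1)) * (4 * (norm b' + 1))"
    using nb by (intro mult_right_mono) (auto simp: \<epsilon>_def)
  then have "\<epsilon> * (4 * (norm b' + 1)) \<le> m" using nb by simp
  then have "4 * \<epsilon> * norm b' + 4 * \<epsilon> \<le> m" by (simp add: algebra_simps)
  moreover have "0 \<le> \<epsilon> * norm b'" using \<epsilon> by simp
  ultimately have \<epsilon>m: "2 * \<epsilon> * norm b' < m" using \<epsilon> by linarith
  have "\<epsilon> * (4 * C) \<le> 1 / (4 * C) * (4 * C)"
    using C by (intro mult_right_mono) (auto simp: \<epsilon>_def)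
  then have \<epsilon>C: "2 * \<epsilon> * C < 1" using C by simp
  define p where "p = z + \<epsilon> *\<^sub>R b'"
  have sq: "(dist p y)\<^sup>2 = (\<epsilon> * norm b')\<^sup>2 - 2 * \<epsilon> * (b' \<bullet> (y - z)) + (norm (y - z))\<^sup>2" for y
    unfolding p_def dist_norm norm_diff_shift_sq using \<epsilon> by (simp add: power_mult_distrib)
  have "Q \<inter> cball z r \<noteq> {}" using zQ r by auto
  from distance_attains_inf[OF r(2) this, of p] obtain y where
    y: "y \<in> Q" "dist z y \<le> r" "\<And>y'. y' \<in> Q \<Longrightarrow> dist z y' \<le> r \<Longrightarrow> dist p y \<le> dist p y'"
    by (metis IntD1 IntD2 IntI mem_cball)
  from b'(2) obtain e0 where e0: "e0 > 0"
    "\<And>d. d > 0 \<Longrightarrow> \<exists>y\<in>Q. dist y z < d \<and> b' \<bullet> (y - z) > e0 * norm (y - z)"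
    unfolding frechet_normal_cone_dist by (meson not_le)
  have "min r (2 * \<epsilon> * e0) > 0" using r \<epsilon> e0 by simp
  \<comment> \<open>Failure of normality of \<open>b'\<close> supplies points of \<open>Q\<close>
    arbitrarily close to \<open>z\<close> at a definite angle with \<open>b'\<close>. Within
    \<open>2 * \<epsilon> * e0\<close> such a point is strictly nearer to \<open>p\<close> than
    \<open>z\<close> is, so the nearest point \<open>y\<close> satisfies \<open>lt\<close>.\<close>
  from e0(2)[OF this] obtain y0 where y0: "y0 \<in> Q" "dist y0 z < r" "dist y0 z < 2 * \<epsilon> * e0"
    "b' \<bullet> (y0 - z) > e0 * norm (y0 - z)" by auto
  have "norm (y0 - z) * norm (y0 - z) \<le> 2 * \<epsilon> * e0 * norm (y0 - z)"
    using y0(3) by (intro mult_right_mono) (auto simp: dist_norm)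
  also have "\<dots> = 2 * \<epsilon> * (e0 * norm (y0 - z))" by simp
  also have "\<dots> < 2 * \<epsilon> * (b' \<bullet> (y0 - z))" using y0(4) \<epsilon> by (intro mult_strict_left_mono) auto
  finally have "(dist p y0)\<^sup>2 < (\<epsilon> * norm b')\<^sup>2" unfolding sq by (simp add: power2_eq_square)
  moreover have "(dist p y)\<^sup>2 \<le> (dist p y0)\<^sup>2"
    using y(3)[OF y0(1)] y0(2) by (intro power_mono) (auto simp: dist_commute)
  ultimately have lt: "(norm (y - z))\<^sup>2 < 2 * \<epsilon> * (b' \<bullet> (y - z))" unfolding sq by simp
  then have nz: "norm (y - z) > 0" by auto
  have "2 * \<epsilon> * (b' \<bullet> (y - z)) \<le> 2 * \<epsilon> * (norm b' * norm (y - z))"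
    using \<epsilon> norm_cauchy_schwarz[of b' "y - z"] by (intro mult_left_mono) auto
  with lt have "norm (y - z) * norm (y - z) < 2 * \<epsilon> * norm b' * norm (y - z)"
    by (simp add: power2_eq_square mult.assoc)
  then have "norm (y - z) < 2 * \<epsilon> * norm b'" using nz by simp
  with \<epsilon>m have ym: "dist y z < m" by (simp add: dist_norm)
  have "y \<notin> P"
  proof
    assume "y \<in> P"
    then have "b' \<bullet> (y - z) \<le> C * (norm (y - z))\<^sup>2" using dC ym by (simp add: m_def)
    then have "2 * \<epsilon> * (b' \<bullet> (y - z)) \<le> 2 * \<epsilon> * (C * (norm (y - z))\<^sup>2)"
      using \<epsilon> by (intro mult_left_mono) auto
    with lt have "1 * (norm (y - z))\<^sup>2 < (2 * \<epsilon> * C) * (norm (y - z))\<^sup>2" by (simp add: mult.assoc)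
    moreover have "(2 * \<epsilon> * C) * (norm (y - z))\<^sup>2 \<le> 1 * (norm (y - z))\<^sup>2"
      using \<epsilon>C by (intro mult_right_mono) auto
    ultimately show False by linarith
  qed
  moreover have "(1 / \<epsilon>) *\<^sub>R (p - y) \<in> frechet_normal_cone Q y"
  proof (rule convex_cone_scaleR[OF convex_cone_frechet_normal_cone])
    show "p - y \<in> frechet_normal_cone Q y"
    proof (rule proximal_in_frechet_normal_cone)
      show "r - dist y z > 0" using ym by (simp add: m_def)
      fix y' assume "y' \<in> Q" "dist y' y < r - dist y z"
      then show "dist p y \<le> dist p y'"
        using y(3)[of y'] dist_triangle[of z y' y] by (simp add: dist_commute)
    qed
  qed (use \<epsilon> in simp)
  moreover have "dist ((1 / \<epsilon>) *\<^sub>R (p - y)) b < \<eta>"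
  proof -
    have "b' \<bullet> (y - z) = (b' - b) \<bullet> (y - z) + b \<bullet> (y - z)" by (simp add: inner_diff_left)
    also have "(b' - b) \<bullet> (y - z) \<le> \<eta> / 6 * norm (y - z)"
      using b'(1) by (intro order_trans[OF norm_cauchy_schwarz mult_right_mono]) (auto simp: dist_norm)
    also have "b \<bullet> (y - z) \<le> \<eta> / 6 * norm (y - z)" using d2(2)[OF y(1)] ym by (simp add: m_def)
    finally have "2 * \<epsilon> * (b' \<bullet> (y - z)) \<le> 2 * \<epsilon> * (\<eta> / 3 * norm (y - z))"
      using \<epsilon> by (intro mult_left_mono) auto
    with lt have "norm (y - z) * norm (y - z) < 2 * \<epsilon> * (\<eta> / 3) * norm (y - z)"
      by (simp add: power2_eq_square mult.assoc)
    then have "norm (y - z) < 2 * \<epsilon> * (\<eta> / 3)" using nz by simp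
    then have "norm (y - z) / \<epsilon> < 2 * \<eta> / 3" using \<epsilon> by (simp add: field_simps)
    moreover have eq: "(1 / \<epsilon>) *\<^sub>R (p - y) - b = (b' - b) - (1 / \<epsilon>) *\<^sub>R (y - z)"
      using \<epsilon> by (simp add: p_def algebra_simps)
    have "norm ((1 / \<epsilon>) *\<^sub>R (p - y) - b) \<le> norm (b' - b) + norm (y - z) / \<epsilon>"
      unfolding eq using norm_triangle_ineq4[of "b' - b" "(1 / \<epsilon>) *\<^sub>R (y - z)"] \<epsilon> by simp
    ultimately show ?thesis using b'(1) \<eta> by (simp add: dist_norm)
  qed
  ultimately show ?thesis using y(1) ym by (auto simp: m_def)
qed

section \<open>Convex cones and their relative boundaries\<close>

text \<open>The approximants have to stay in \<open>L\<close>: if \<open>L\<close> is a proper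
  subspace, every point of \<open>C\<close> is a boundary point in the ambient space, while the
  quadratic estimates below hold only for vectors of the normal space.\<close>

definition boundary_in :: "'a::real_normed_vector set \<Rightarrow> 'a set \<Rightarrow> 'a set" where
  "boundary_in L C = {b \<in> C. \<forall>\<eta>>0. \<exists>b'\<in>L. dist b' b < \<eta> \<and> b' \<notin> C}"

text \<open>If the whole half-line stayed in \<open>C\<close>, rescaling its points and passing to
  the limit would put the direction \<open>w\<close> into the closed cone. By convexity the
  half-line does not return after leaving, so its last point in \<open>C\<close> is a boundary
  point, approached from outside along the same line.\<close>

lemma convex_cone_ray_exit:
  fixes C :: "'a::real_normed_vector set"
  assumes C: "closed C" "convex_cone C" and v: "v \<in> C" and w: "w \<notin> C"
    and L: "subspace L" "C \<subseteq> L" "w \<in> L"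
  obtains t where "0 \<le> t" "v + t *\<^sub>R w \<in> boundary_in L C"
proof -
  define A where "A = {t. 0 \<le> t \<and> v + t *\<^sub>R w \<in> C}"
  have "w \<noteq> 0" using w C(2) convex_cone_contains_0 by auto
  have "\<exists>t0\<ge>0. v + t0 *\<^sub>R w \<notin> C"
  proof (rule ccontr)
    assume "\<not> ?thesis"
    then have all: "v + t *\<^sub>R w \<in> C" if "t \<ge> 0" for t using that by blast
    have "(1 / real (Suc n)) *\<^sub>R v + w \<in> C" for n
      using convex_cone_scaleR[OF C(2) _ all, of "1 / real (Suc n)" "real (Suc n)"]
      by (simp add: scaleR_add_right)
    moreover have "(\<lambda>n. (1 / real (Suc n)) *\<^sub>R v + w) \<longlonglongrightarrow> 0 *\<^sub>R v + w"
      by (intro tendsto_intros LIMSEQ_Suc lim_1_over_n)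
    ultimately have "0 *\<^sub>R v + w \<in> C" by (rule closed_sequentially[OF C(1)])
    then have "w \<in> C" by simp
    with w show False by simp
  qed
  then obtain t0 where t0: "t0 \<ge> 0" "v + t0 *\<^sub>R w \<notin> C" by blast
  have bdd: "t \<le> t0" if "t \<in> A" for t
  proof (rule ccontr)
    assume "\<not> t \<le> t0"
    with t0(1) have t: "t > 0" "t0 / t \<le> 1" "t0 / t \<ge> 0" by auto
    have "convex C" using C(2) by (simp add: convex_cone_def)
    from convexD_alt[OF this v, of "v + t *\<^sub>R w" "t0 / t"] that t
    have "(1 - t0 / t) *\<^sub>R v + (t0 / t) *\<^sub>R (v + t *\<^sub>R w) \<in> C" by (simp add: A_def)
    moreover have "(1 - t0 / t) *\<^sub>R v + (t0 / t) *\<^sub>R (v + t *\<^sub>R w) = v + t0 *\<^sub>R w"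
      using t(1) by (simp add: algebra_simps)
    ultimately show False using t0(2) by simp
  qed
  have "A = {0..} \<inter> (\<lambda>t. v + t *\<^sub>R w) -` C" by (auto simp: A_def)
  then have "closed A" using C(1) by (simp only:) (intro closed_Int closed_vimage closed_atLeast continuous_intros)
  moreover have A0: "0 \<in> A" using v by (simp add: A_def)
  moreover have bdA: "bdd_above A" using bdd by (auto simp: bdd_above_def)
  ultimately have S: "Sup A \<in> A" using closed_contains_Sup by blast
  have vL: "v \<in> L" using v L by blast
  have "v + Sup A *\<^sub>R w \<in> boundary_in L C"
    unfolding boundary_in_def
  proof (intro CollectI conjI allI impI)
    show "v + Sup A *\<^sub>R w \<in> C" using S by (simp add: A_def)
    fix \<eta> :: real assume "\<eta> > 0"
    define s where "s = \<eta> / (2 * norm w)"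
    have s: "s > 0" using \<open>\<eta> > 0\<close> \<open>w \<noteq> 0\<close> by (simp add: s_def)
    have "Sup A + s \<notin> A" using cSup_upper[OF _ bdA, of "Sup A + s"] s by auto
    moreover have "Sup A + s \<ge> 0" using S s by (simp add: A_def)
    ultimately have "v + (Sup A + s) *\<^sub>R w \<notin> C" by (simp add: A_def)
    moreover have "v + (Sup A + s) *\<^sub>R w \<in> L"
      using L vL by (intro subspace_add subspace_scale)
    moreover have "dist (v + (Sup A + s) *\<^sub>R w) (v + Sup A *\<^sub>R w) < \<eta>"
      using \<open>\<eta> > 0\<close> \<open>w \<noteq> 0\<close> s by (simp add: dist_norm scaleR_add_left s_def)
    ultimately show "\<exists>b'\<in>L. dist b' (v + Sup A *\<^sub>R w) < \<eta> \<and> b' \<notin> C" by blast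
  qed
  with S that show ?thesis by (auto simp: A_def)
qed

text \<open>If neither \<open>u\<close> nor \<open>- u\<close> is in \<open>C\<close>, the line
  through \<open>v\<close> leaves \<open>C\<close> at both ends and \<open>v\<close> lies between
  the two exit points. If one of them is in \<open>C\<close>, it is itself a boundary vector: exit
  in the opposite direction and return by adding a multiple of it.\<close>

lemma convex_cone_boundary_decomposition:
  fixes C :: "'a::real_normed_vector set"
  assumes C: "closed C" "convex_cone C" and L: "subspace L" "C \<subseteq> L" "u \<in> L"
    and line: "u \<notin> C \<or> - u \<notin> C"
    and bdry: "u \<in> C \<Longrightarrow> u \<in> boundary_in L C" "- u \<in> C \<Longrightarrow> - u \<in> boundary_in L C"
  shows "C \<subseteq> convex_cone hull (boundary_in L C)"
proof
  fix v assume v: "v \<in> C"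
  let ?H = "convex_cone hull (boundary_in L C)"
  have one: "v \<in> ?H" if w: "w \<in> boundary_in L C" "- w \<notin> C" "w \<in> L" for w
  proof -
    obtain t where t: "0 \<le> t" "v + t *\<^sub>R (- w) \<in> boundary_in L C"
      using convex_cone_ray_exit[OF C v w(2) L(1,2)] L(1) w(3) subspace_neg by metis
    then have "(v + t *\<^sub>R (- w)) + t *\<^sub>R w \<in> ?H"
      using w(1) by (intro convex_cone_hull_add convex_cone_hull_mul hull_inc)
    then show ?thesis by simp
  qed
  have mL: "- u \<in> L" using L subspace_neg by blast
  consider "u \<in> C" "- u \<notin> C" | "- u \<in> C" "u \<notin> C" | "u \<notin> C" "- u \<notin> C" using line by blast
  then show "v \<in> ?H"
  proof cases
    case 1
    with one[of u] bdry L show ?thesis by simp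
  next
    case 2
    with one[of "- u"] bdry mL show ?thesis by simp
  next
    case 3
    obtain t where t: "0 \<le> t" "v + t *\<^sub>R u \<in> boundary_in L C"
      using convex_cone_ray_exit[OF C v 3(1) L] by blast
    obtain s where s: "0 \<le> s" "v + s *\<^sub>R (- u) \<in> boundary_in L C"
      using convex_cone_ray_exit[OF C v 3(2) L(1,2) mL] by blast
    show ?thesis
    proof (cases "t + s = 0")
      case True
      then have "t = 0" using t s by simp
      with t show ?thesis by (simp add: hull_inc)
    next
      case False
      \<comment> \<open>The weights are chosen so that the multiples of \<open>u\<close>
        cancel.\<close>
      have "(s / (t + s)) *\<^sub>R (v + t *\<^sub>R u) + (t / (t + s)) *\<^sub>R (v + s *\<^sub>R (- u)) \<in> ?H"
        using t s by (intro convex_cone_hull_add convex_cone_hull_mul hull_inc) auto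
      moreover have "(s / (t + s)) *\<^sub>R (v + t *\<^sub>R u) + (t / (t + s)) *\<^sub>R (v + s *\<^sub>R (- u))
          = (s / (t + s) + t / (t + s)) *\<^sub>R v"
        by (simp add: algebra_simps)
      moreover have "s / (t + s) + t / (t + s) = 1"
        using False by (simp add: add_divide_distrib[symmetric] add.commute)
      ultimately show ?thesis by simp
    qed
  qed
qed

section \<open>Twice continuously differentiable functions and submanifolds\<close>

lemma has_derivative_lipschitz_at:
  assumes "(f has_derivative D) (at p)"
  obtains K d where "K > 0" "d > 0" "\<And>y. dist y p < d \<Longrightarrow> norm (f y - f p) \<le> K * norm (y - p)"
proof -
  from assms have bl: "bounded_linear D" by (rule has_derivative_bounded_linear)
  from assms obtain d where d: "d > 0"
    "\<And>y. norm (y - p) < d \<Longrightarrow> norm (f y - f p - D (y - p)) \<le> 1 * norm (y - p)"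
    unfolding has_derivative_at_alt by (meson zero_less_one)
  have "norm (f y - f p) \<le> (onorm D + 1) * norm (y - p)" if "dist y p < d" for y
  proof -
    have "norm (f y - f p) \<le> norm (f y - f p - D (y - p)) + norm (D (y - p))"
      using norm_triangle_sub[of "f y - f p" "D (y - p)"] by simp
    also have "\<dots> \<le> 1 * norm (y - p) + onorm D * norm (y - p)"
      using d(2)[of y] that onorm[OF bl] by (intro add_mono) (auto simp: dist_norm)
    finally show ?thesis by (simp add: algebra_simps)
  qed
  moreover have "onorm D + 1 > 0" using onorm_pos_le[OF bl] by simp
  ultimately show ?thesis using that d(1) by blast
qed

text \<open>Differentiability of \<open>g'\<close> at \<open>p\<close> bounds its variation on the
  ball of radius \<open>norm (q - p)\<close> by a multiple of that radius; the mean value estimate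
  contributes the second factor.\<close>

lemma C2_on_second_order:
  fixes g :: "'a::real_normed_vector \<Rightarrow> 'b::real_normed_vector"
  assumes U: "open U" "p \<in> U"
    and g': "\<And>x. x \<in> U \<Longrightarrow> (g has_derivative blinfun_apply (g' x)) (at x)"
    and g'': "(g' has_derivative D2) (at p)"
  obtains C d where "C > 0" "d > 0"
    "\<And>q. dist q p < d \<Longrightarrow> norm (g q - g p - g' p (q - p)) \<le> C * (norm (q - p))\<^sup>2"
proof -
  obtain K d where K: "K > 0" "d > 0" "\<And>y. dist y p < d \<Longrightarrow> norm (g' y - g' p) \<le> K * norm (y - p)"
    using has_derivative_lipschitz_at[OF g''] by blast
  obtain e where e: "e > 0" "ball p e \<subseteq> U" using U open_contains_ball by blast
  have "norm (g q - g p - g' p (q - p)) \<le> K * (norm (q - p))\<^sup>2" if q: "dist q p < min d e" for q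
  proof -
    have "norm (g q - g p - g' p (q - p)) \<le> norm (q - p) * (K * norm (q - p))"
    proof (rule differentiable_bound_linearization[where S = "cball p (norm (q - p))"])
      fix t :: real assume "t \<in> {0..1}"
      then have "norm (t *\<^sub>R (q - p)) \<le> 1 * norm (q - p)"
        unfolding norm_scaleR by (intro mult_right_mono) auto
      then show "p + t *\<^sub>R (q - p) \<in> cball p (norm (q - p))" by (simp add: dist_norm)
    next
      fix x assume x: "x \<in> cball p (norm (q - p))"
      then have xd: "dist x p < min d e" "norm (x - p) \<le> norm (q - p)"
        using q by (auto simp: dist_norm norm_minus_commute)
      then have "x \<in> U" using e by (auto simp: dist_commute)
      then show "(g has_derivative blinfun_apply (g' x)) (at x within cball p (norm (q - p)))"
        using g' has_derivative_at_withinI by blast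
      have "norm (g' x - g' p) \<le> K * norm (q - p)"
        using K(3)[of x] xd(1) mult_left_mono[OF xd(2) less_imp_le[OF K(1)]] by simp
      then show "onorm (blinfun_apply (g' x) - blinfun_apply (g' p)) \<le> K * norm (q - p)"
        unfolding norm_blinfun.rep_eq minus_blinfun.rep_eq by (simp add: fun_diff_def)
    qed simp
    then show ?thesis by (simp add: power2_eq_square mult.left_commute)
  qed
  then show ?thesis using that[of K "min d e"] K e by auto
qed

text \<open>Continuity of the gradient serves the open strata, where gradients at points of
  \<open>\<Omega>\<close> have to converge; the quadratic remainder serves the strata of smaller
  dimension.\<close>

lemma C2_gradient:
  fixes g :: "'a::euclidean_space \<Rightarrow> real"
  assumes "C2_on g UNIV"
  obtains grad where "\<And>x. GDERIV g x :> grad x" "continuous_on UNIV grad"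
    "\<And>x. \<exists>C d. d > 0 \<and> (\<forall>y. dist y x < d \<longrightarrow> \<bar>g y - g x - grad x \<bullet> (y - x)\<bar> \<le> C * (norm (y - x))\<^sup>2)"
proof -
  from assms obtain g' g'' where
    g': "\<And>x. (g has_derivative blinfun_apply (g' x)) (at x)" and
    g'': "\<And>x. (g' has_derivative blinfun_apply (g'' x :: 'a \<Rightarrow>\<^sub>L 'a \<Rightarrow>\<^sub>L real)) (at x)"
    unfolding C2_on_def by auto
  define grad where "grad x = (\<Sum>i\<in>Basis. g' x i *\<^sub>R i)" for x
  have rep: "g' x h = h \<bullet> grad x" for x h
  proof -
    have "g' x h = g' x (\<Sum>i\<in>Basis. (h \<bullet> i) *\<^sub>R i)" by (simp add: euclidean_representation)
    also have "\<dots> = (\<Sum>i\<in>Basis. (h \<bullet> i) * g' x i)"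
      by (simp add: blinfun.sum_right blinfun.scaleR_right)
    finally show ?thesis by (simp add: grad_def inner_sum_right mult.commute)
  qed
  have "GDERIV g x :> grad x" for x
    unfolding gderiv_def using g'[of x] by (simp add: rep[abs_def])
  moreover have "continuous_on UNIV g'"
    using g'' has_derivative_continuous continuous_at_imp_continuous_on by blast
  then have "continuous_on UNIV grad"
    unfolding grad_def[abs_def] by (intro continuous_intros)
  moreover have "\<exists>C d. d > 0 \<and> (\<forall>y. dist y x < d \<longrightarrow>
      \<bar>g y - g x - grad x \<bullet> (y - x)\<bar> \<le> C * (norm (y - x))\<^sup>2)" for x
  proof -
    obtain C d where "C > 0" "d > 0"
      "\<And>q. dist q x < d \<Longrightarrow> norm (g q - g x - g' x (q - x)) \<le> C * (norm (q - x))\<^sup>2"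
      using C2_on_second_order[OF open_UNIV UNIV_I g' g''] by blast
    then show ?thesis by (intro exI[of _ C] exI[of _ d]) (simp add: rep inner_commute)
  qed
  ultimately show ?thesis using that by blast
qed

text \<open>In a chart \<open>M\<close> becomes a piece of a linear subspace, which is closed. In
  the induction over strata this ensures that points near \<open>x\<close> off \<open>M\<close> are
  not adherent to \<open>M\<close>.\<close>

lemma C2_submanifold_locally_closed:
  assumes "C2_submanifold M" "x \<in> M"
  obtains U where "open U" "x \<in> U" "closure M \<inter> U \<subseteq> M"
proof -
  from assms obtain U V \<phi> \<psi> L where U: "x \<in> U" "C2_on \<phi> U" "homeomorphism U V \<phi> \<psi>"
    "subspace (L::'a set)" "\<phi> ` (M \<inter> U) = L \<inter> V"
    unfolding C2_submanifold_def by metis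
  have "open U" using U(2) by (simp add: C2_on_def)
  moreover have "closure M \<inter> U \<subseteq> M"
  proof
    fix y assume y: "y \<in> closure M \<inter> U"
    then have "y \<in> closure (M \<inter> U)"
      using open_Int_closure_subset[OF \<open>open U\<close>, of M] by (auto simp: Int_commute)
    then obtain Y where Y: "\<And>i::nat. Y i \<in> M \<inter> U" "Y \<longlonglongrightarrow> y"
      unfolding closure_sequential by blast
    have "isCont \<phi> y"
      using U(3) y \<open>open U\<close> by (auto simp: homeomorphism_def continuous_on_eq_continuous_at)
    then have "(\<lambda>i. \<phi> (Y i)) \<longlonglongrightarrow> \<phi> y" using Y(2) by (rule isCont_tendsto_compose)
    moreover have "\<phi> (Y i) \<in> L" for i using Y(1) U(5) by blast
    ultimately have "\<phi> y \<in> L" using closed_sequentially[OF closed_subspace[OF U(4)], of "\<lambda>i. \<phi> (Y i)"] by simp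
    moreover have "\<phi> y \<in> V" using y U(3) by (auto simp: homeomorphism_def)
    ultimately have "\<phi> y \<in> \<phi> ` (M \<inter> U)" using U(5) by blast
    then obtain y' where y': "y' \<in> M \<inter> U" "\<phi> y = \<phi> y'" by blast
    have "\<psi> (\<phi> y) = y" "\<psi> (\<phi> y') = y'" using U(3) y y'(1) by (auto simp: homeomorphism_def)
    then have "y = y'" using y'(2) by metis
    then show "y \<in> M" using y'(1) by blast
  qed
  ultimately show ?thesis using U(1) that[of U] by blast
qed

text \<open>Everything is read off the inverse chart \<open>\<psi>\<close>. Lines in
  \<open>L\<close> are mapped to the curves; for \<open>b\<close> orthogonal to \<open>T\<close> the
  first-order Taylor term of \<open>\<psi>\<close> disappears and the quadratic remainder is
  left.\<close>

lemma C2_submanifold_tangent: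
  fixes M :: "'a::euclidean_space set"
  assumes "C2_submanifold M" "x \<in> M"
  obtains (full) U where "open U" "x \<in> U" "U \<subseteq> M"
  | (proper) T where "subspace T" "T \<noteq> UNIV"
      "\<And>t. t \<in> T \<Longrightarrow> \<exists>\<gamma>. (\<gamma> has_vector_derivative t) (at 0) \<and> \<gamma> 0 = x \<and> (\<forall>\<^sub>F s in nhds (0::real). \<gamma> s \<in> M)"
      "\<And>b. (\<And>t. t \<in> T \<Longrightarrow> b \<bullet> t = 0) \<Longrightarrow>
         \<exists>C d. d > 0 \<and> (\<forall>y\<in>M. dist y x < d \<longrightarrow> b \<bullet> (y - x) \<le> C * (norm (y - x))\<^sup>2)"
proof -
  from assms obtain k U V \<phi> \<psi> and L :: "'a set" where
    U: "x \<in> U" "C2_on \<phi> U" "C2_on \<psi> V" "homeomorphism U V \<phi> \<psi>"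
      "subspace L" "\<phi> ` (M \<inter> U) = L \<inter> V"
    unfolding C2_submanifold_def by metis
  have oU: "open U" and oV: "open V" using U(2,3) by (auto simp: C2_on_def)
  have hom: "\<And>y. y \<in> U \<Longrightarrow> \<psi> (\<phi> y) = y" "\<And>q. q \<in> V \<Longrightarrow> \<phi> (\<psi> q) = q"
    "\<And>y. y \<in> U \<Longrightarrow> \<phi> y \<in> V" "\<And>q. q \<in> V \<Longrightarrow> \<psi> q \<in> U"
    using U(4) by (auto simp: homeomorphism_def)
  have inM: "\<psi> q \<in> M" if "q \<in> L" "q \<in> V" for q
  proof -
    have "q \<in> \<phi> ` (M \<inter> U)" using U(6) that by blast
    then show ?thesis using hom by auto
  qed
  define p where "p = \<phi> x"
  have p: "p \<in> V" "\<psi> p = x" "p \<in> L" using U(1,6) hom assms(2) by (auto simp: p_def)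
  show ?thesis
  proof (cases "L = UNIV")
    case True
    have "U \<subseteq> M"
    proof
      fix y assume "y \<in> U"
      then show "y \<in> M" using inM[of "\<phi> y"] hom True by simp
    qed
    with oU U(1) show ?thesis using full by blast
  next
    case False
    from U(3) obtain \<psi>' \<psi>'' where \<psi>': "\<And>q. q \<in> V \<Longrightarrow> (\<psi> has_derivative blinfun_apply (\<psi>' q)) (at q)"
      and \<psi>'': "\<And>q. q \<in> V \<Longrightarrow> (\<psi>' has_derivative blinfun_apply (\<psi>'' q :: 'a \<Rightarrow>\<^sub>L 'a \<Rightarrow>\<^sub>L 'a)) (at q)"
      unfolding C2_on_def by blast
    obtain \<phi>' where \<phi>': "(\<phi> has_derivative \<phi>') (at x)"
      using U(1,2) unfolding C2_on_def by blast
    define T where "T = blinfun_apply (\<psi>' p) ` L"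
    have lin: "linear (blinfun_apply (\<psi>' p))"
      by (simp add: blinfun.bounded_linear_right bounded_linear.linear)
    have "dim T \<le> dim L" unfolding T_def by (rule dim_image_le[OF lin])
    also have "dim L < DIM('a)" using False U(5) dim_eq_full[of L] dim_subset_UNIV[of L] span_eq_iff
      by (metis order_le_less)
    finally have "T \<noteq> UNIV" by auto
    moreover have "subspace T" unfolding T_def using lin U(5) by (rule linear_subspace_image)
    moreover have "\<exists>\<gamma>. (\<gamma> has_vector_derivative t) (at 0) \<and> \<gamma> 0 = x \<and> (\<forall>\<^sub>F s in nhds (0::real). \<gamma> s \<in> M)"
      if "t \<in> T" for t
    proof -
      from that obtain l where l: "l \<in> L" "t = \<psi>' p l" by (auto simp: T_def)
      define \<gamma> where "\<gamma> = (\<lambda>s. \<psi> (p + s *\<^sub>R l))"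
      have "((\<lambda>s. p + s *\<^sub>R l) has_derivative (\<lambda>s. s *\<^sub>R l)) (at 0)"
        by (auto intro!: derivative_eq_intros)
      moreover have "(\<psi> has_derivative blinfun_apply (\<psi>' p)) (at (p + 0 *\<^sub>R l))"
        using \<psi>'[OF p(1)] by simp
      ultimately have "(\<gamma> has_derivative (\<lambda>s. \<psi>' p (s *\<^sub>R l))) (at 0)"
        unfolding \<gamma>_def by (rule has_derivative_compose)
      then have "(\<gamma> has_vector_derivative t) (at 0)"
        unfolding has_vector_derivative_def by (simp add: l(2) blinfun.scaleR_right)
      moreover have "\<gamma> 0 = x" using p by (simp add: \<gamma>_def)
      moreover have "\<forall>\<^sub>F s in nhds 0. \<gamma> s \<in> M"
      proof -
        have "((\<lambda>s. p + s *\<^sub>R l) \<longlongrightarrow> p + 0 *\<^sub>R l) (nhds 0)"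
          by (intro tendsto_intros filterlim_ident)
        then have "\<forall>\<^sub>F s in nhds 0. p + s *\<^sub>R l \<in> V"
          using topological_tendstoD[of _ _ _ V] oV p(1) by simp
        then show ?thesis
        proof eventually_elim
          case (elim s)
          have "p + s *\<^sub>R l \<in> L" using p(3) l(1) U(5) by (simp add: subspace_add subspace_scale)
          with elim show ?case unfolding \<gamma>_def using inM by blast
        qed
      qed
      ultimately show ?thesis by blast
    qed
    moreover have "\<exists>C d. d > 0 \<and> (\<forall>y\<in>M. dist y x < d \<longrightarrow> b \<bullet> (y - x) \<le> C * (norm (y - x))\<^sup>2)"
      if orth: "\<And>t. t \<in> T \<Longrightarrow> b \<bullet> t = 0" for b
    proof -
      obtain C1 d1 where 1: "C1 > 0" "d1 > 0"
        "\<And>q. dist q p < d1 \<Longrightarrow> norm (\<psi> q - \<psi> p - \<psi>' p (q - p)) \<le> C1 * (norm (q - p))\<^sup>2"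
        using C2_on_second_order[OF oV p(1) \<psi>' \<psi>''[OF p(1)]] by blast
      \<comment> \<open>The Taylor bound is in terms of \<open>norm (q - p)\<close> in the chart;
        this Lipschitz estimate for \<open>\<phi>\<close> converts it to
        \<open>norm (y - x)\<close>, and the radius \<open>d1 / K\<close> keeps \<open>q\<close>
        where the bound is valid.\<close>
      obtain K d2 where 2: "K > 0" "d2 > 0" "\<And>y. dist y x < d2 \<Longrightarrow> norm (\<phi> y - \<phi> x) \<le> K * norm (y - x)"
        using has_derivative_lipschitz_at[OF \<phi>'] by blast
      obtain d3 where d3: "d3 > 0" "ball x d3 \<subseteq> U" using oU U(1) open_contains_ball by blast
      define d where "d = min (min d2 d3) (d1 / K)"
      have "b \<bullet> (y - x) \<le> norm b * C1 * K\<^sup>2 * (norm (y - x))\<^sup>2" if y: "y \<in> M" "dist y x < d" for y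
      proof -
        define q where "q = \<phi> y"
        have yU: "y \<in> U" using y d3 by (auto simp: d_def dist_commute)
        have qp: "norm (q - p) \<le> K * norm (y - x)" using 2(3)[of y] y by (simp add: d_def q_def p_def)
        have "K * norm (y - x) < d1" using y(2) 2(1) by (simp add: d_def dist_norm field_simps)
        with qp have "dist q p < d1" by (simp add: dist_norm)
        moreover have "q \<in> L" using y yU U(6) by (auto simp: q_def)
        then have "\<psi>' p (q - p) \<in> T" unfolding T_def using p(3) U(5) subspace_diff by blast
        then have "b \<bullet> (y - x) = b \<bullet> (\<psi> q - \<psi> p - \<psi>' p (q - p))"
          using orth hom yU p(2) by (simp add: inner_diff_right q_def)
        then have "b \<bullet> (y - x) \<le> norm b * norm (\<psi> q - \<psi> p - \<psi>' p (q - p))"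
          using norm_cauchy_schwarz by metis
        ultimately have "b \<bullet> (y - x) \<le> norm b * (C1 * (norm (q - p))\<^sup>2)"
          using 1(3)[of q] mult_left_mono[of _ _ "norm b"] by (meson norm_ge_zero order_trans)
        also have "(norm (q - p))\<^sup>2 \<le> (K * norm (y - x))\<^sup>2" using qp by (simp add: power_mono)
        finally show ?thesis using 1(1) by (simp add: mult_left_mono power_mult_distrib mult.assoc)
      qed
      moreover have "d > 0" using 1 2 d3 by (simp add: d_def)
      ultimately show ?thesis by blast
    qed
    ultimately show ?thesis using proper by blast
  qed
qed

section \<open>Normals to epigraphs\<close>

text \<open>Divide the normal inequality along the curve by \<open>s\<close> and let
  \<open>s\<close> tend to 0 from the right. Only positive times are required to stay in
  \<open>Q\<close>, because the vertical line through a graph point is in the epigraph on one side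
  only.\<close>

lemma frechet_normal_curve:
  fixes \<gamma> :: "real \<Rightarrow> 'a::real_inner"
  assumes w: "w \<in> frechet_normal_cone Q z" and \<gamma>: "(\<gamma> has_vector_derivative t) (at 0)" "\<gamma> 0 = z"
    and Q: "\<forall>\<^sub>F s in at_right 0. \<gamma> s \<in> Q"
  shows "w \<bullet> t \<le> 0"
proof -
  have lim: "((\<lambda>s. (1 / s) *\<^sub>R (\<gamma> s - z)) \<longlongrightarrow> t) (at_right 0)"
  proof (rule tendstoI)
    fix e :: real assume "e > 0"
    then have "e / 2 > 0" by simp
    with \<gamma>(1) obtain d where d: "d > 0"
      "\<And>s. norm (s - 0) < d \<Longrightarrow> norm (\<gamma> s - \<gamma> 0 - (s - 0) *\<^sub>R t) \<le> e / 2 * norm (s - 0)"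
      unfolding has_vector_derivative_def has_derivative_at_alt by blast
    have "\<forall>\<^sub>F s in at_right 0. s \<in> {0<..<d}" using d(1) by (rule eventually_at_right_real)
    then show "\<forall>\<^sub>F s in at_right 0. dist ((1 / s) *\<^sub>R (\<gamma> s - z)) t < e"
    proof eventually_elim
      case (elim s)
      have "(1 / s) *\<^sub>R (\<gamma> s - z) - t = (1 / s) *\<^sub>R (\<gamma> s - z - s *\<^sub>R t)"
        using elim by (simp add: scaleR_diff_right)
      then have "dist ((1 / s) *\<^sub>R (\<gamma> s - z)) t = norm (\<gamma> s - z - s *\<^sub>R t) / s"
        using elim by (simp add: dist_norm)
      also have "\<dots> \<le> e / 2" using d(2)[of s] elim \<gamma>(2) by (simp add: divide_le_eq)
      finally show ?case using \<open>e > 0\<close> by simp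
    qed
  qed
  have bound: "w \<bullet> t \<le> e * norm t" if e: "e > 0" for e
  proof -
    from w e obtain d where d: "d > 0"
      "\<And>y. y \<in> Q \<Longrightarrow> dist y z < d \<Longrightarrow> w \<bullet> (y - z) \<le> e * norm (y - z)"
      unfolding frechet_normal_cone_dist by blast
    have "(\<gamma> \<longlongrightarrow> z) (at_right 0)"
      using isContD[OF has_vector_derivative_continuous[OF \<gamma>(1)]] unfolding \<gamma>(2)
      by (rule tendsto_mono[OF at_le[OF subset_UNIV]])
    then have "\<forall>\<^sub>F s in at_right 0. dist (\<gamma> s) z < d" using d(1) by (rule tendstoD)
    moreover have "\<forall>\<^sub>F s::real in at_right 0. s > 0" by (rule eventually_at_right_less)
    ultimately have "\<forall>\<^sub>F s in at_right 0.
        w \<bullet> ((1 / s) *\<^sub>R (\<gamma> s - z)) \<le> e * norm ((1 / s) *\<^sub>R (\<gamma> s - z))"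
      using Q
    proof eventually_elim
      case (elim s)
      then show ?case using d(2)[of "\<gamma> s"] by (simp add: divide_right_mono)
    qed
    then show ?thesis
      by (rule tendsto_le[OF trivial_limit_at_right_real
            tendsto_mult[OF tendsto_const tendsto_norm[OF lim]] tendsto_inner[OF tendsto_const lim]])
  qed
  have "w \<bullet> t \<le> e" if "e > 0" for e
  proof -
    \<comment> \<open>Dividing by \<open>norm t + 1\<close> instead of \<open>norm t\<close> covers
      \<open>t = 0\<close>.\<close>
    have "norm t + 1 > 0" by (simp add: add_nonneg_pos)
    then have "w \<bullet> t \<le> e / (norm t + 1) * norm t"
      by (intro bound divide_pos_pos that)
    also have "\<dots> \<le> e / (norm t + 1) * (norm t + 1)"
      using that \<open>norm t + 1 > 0\<close> by (intro mult_left_mono) auto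
    finally show ?thesis using \<open>norm t + 1 > 0\<close> by simp
  qed
  then show ?thesis by (rule field_le_epsilon) simp
qed

text \<open>A point of the graph only where \<open>f\<close> is finite: \<open>real_of_ereal\<close>
  sends both infinities to 0.\<close>

definition graph_pt :: "('a \<Rightarrow> ereal) \<Rightarrow> 'a \<Rightarrow> 'a \<times> real" where
  "graph_pt f x = (x, real_of_ereal (f x))"

lemma graph_pt_in_epi: "\<bar>f x\<bar> \<noteq> \<infinity> \<Longrightarrow> graph_pt f x \<in> epi f"
  by (auto simp: graph_pt_def epi_def ereal_real)

text \<open>The upward vertical half-line stays in the epigraph. Read backwards, a positive last
  coordinate certifies that a vector is not a normal, which is how horizontal normals are later
  recognised as boundary vectors.\<close>

lemma frechet_normal_epi_snd:
  fixes f :: "'a::real_inner \<Rightarrow> ereal"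
  assumes "w \<in> frechet_normal_cone (epi f) z" "z \<in> epi f"
  shows "snd w \<le> 0"
proof -
  have "((\<lambda>s::real. z + s *\<^sub>R (0, 1)) has_vector_derivative (0, 1)) (at 0)"
    by (auto intro!: derivative_eq_intros simp: zero_prod_def)
  moreover have "\<forall>\<^sub>F s in at_right 0. z + s *\<^sub>R (0::'a, 1::real) \<in> epi f"
    using eventually_at_right_less[of "0::real"]
  proof eventually_elim
    case (elim s)
    have "f (fst z) \<le> ereal (snd z)" using assms(2) by (auto simp: epi_def)
    also have "\<dots> \<le> ereal (snd z + s)" using elim by simp
    finally show ?case by (simp add: epi_def case_prod_beta)
  qed
  ultimately have "w \<bullet> (0, 1) \<le> 0"
    using frechet_normal_curve[OF assms(1), of "\<lambda>s. z + s *\<^sub>R (0, 1)" "(0, 1)"]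
    by (simp add: zero_prod_def)
  then show ?thesis by (simp add: inner_prod_def)
qed

lemma limiting_normal_epi_snd:
  fixes f :: "'a::real_inner \<Rightarrow> ereal"
  assumes "w \<in> limiting_normal_cone (epi f) z"
  shows "snd w \<le> 0"
proof -
  obtain X V where XV: "\<And>i::nat. X i \<in> epi f \<and> V i \<in> frechet_normal_cone (epi f) (X i)"
    "V \<longlonglongrightarrow> w" using assms unfolding limiting_normal_cone_def by blast
  have "\<And>i. snd (V i) \<le> 0" using XV(1) frechet_normal_epi_snd by blast
  with tendsto_snd[OF XV(2)] show ?thesis by (intro LIMSEQ_le_const2) auto
qed

text \<open>The lifted curve \<open>(\<gamma> s, g (\<gamma> s))\<close> runs in the epigraph with
  velocity \<open>(t, t \<bullet> v)\<close>, and pairing \<open>w\<close> with it regroups to the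
  stated product.\<close>

lemma frechet_normal_epi_curve:
  fixes f :: "'a::real_inner \<Rightarrow> ereal"
  assumes w: "w \<in> frechet_normal_cone (epi f) (x, g x)"
    and \<gamma>: "(\<gamma> has_vector_derivative t) (at 0)" "\<gamma> 0 = x"
    and fg: "\<forall>\<^sub>F s in nhds 0. f (\<gamma> s) = ereal (g (\<gamma> s))" and g: "GDERIV g x :> v"
  shows "(fst w + snd w *\<^sub>R v) \<bullet> t \<le> 0"
proof -
  have "(g has_derivative (\<lambda>h. h \<bullet> v)) (at (\<gamma> 0))" using g \<gamma>(2) by (simp add: gderiv_def)
  with \<gamma>(1) have "((\<lambda>s. g (\<gamma> s)) has_derivative (\<lambda>s. (s *\<^sub>R t) \<bullet> v)) (at 0)"
    unfolding has_vector_derivative_def by (rule has_derivative_compose)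
  then have "((\<lambda>s. (\<gamma> s, g (\<gamma> s))) has_vector_derivative (t, t \<bullet> v)) (at 0)"
    using has_derivative_Pair[OF \<gamma>(1)[unfolded has_vector_derivative_def]]
    unfolding has_vector_derivative_def by simp
  moreover have "\<forall>\<^sub>F s in at_right 0. (\<gamma> s, g (\<gamma> s)) \<in> epi f"
    using filter_leD[OF at_within_le_nhds fg] by eventually_elim (simp add: epi_def)
  ultimately have "w \<bullet> (t, t \<bullet> v) \<le> 0" using frechet_normal_curve[OF w] \<gamma>(2) by simp
  then show ?thesis by (simp add: inner_prod_def inner_add_left inner_commute[of v t])
qed

lemma gradient_in_frechet_normal_cone:
  fixes f :: "'a::real_inner \<Rightarrow> ereal"
  assumes "has_egradient f x g"
  shows "(g, -1) \<in> frechet_normal_cone (epi f) (graph_pt f x)"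
  unfolding frechet_normal_cone_dist
proof (intro allI impI)
  fix e :: real assume e: "e > 0"
  define F where "F y = real_of_ereal (f y)" for y
  from assms have fin: "\<forall>\<^sub>F y in nhds x. \<bar>f y\<bar> \<noteq> \<infinity>" and "(F has_derivative (\<lambda>h. h \<bullet> g)) (at x)"
    unfolding has_egradient_def gderiv_def F_def by auto
  with e obtain d where d: "d > 0"
    "\<And>y. norm (y - x) < d \<Longrightarrow> norm (F y - F x - (y - x) \<bullet> g) \<le> e * norm (y - x)"
    unfolding has_derivative_at_alt by blast
  from fin obtain d2 where d2: "d2 > 0" "\<And>y. dist y x < d2 \<Longrightarrow> \<bar>f y\<bar> \<noteq> \<infinity>"
    unfolding eventually_nhds_metric by blast
  have "(g, -1) \<bullet> (z - graph_pt f x) \<le> e * norm (z - graph_pt f x)"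
    if z: "z \<in> epi f" "dist z (graph_pt f x) < min d d2" for z
  proof -
    obtain y r where yr: "z = (y, r)" by (cases z)
    have nle: "norm (y - x) \<le> norm (z - graph_pt f x)"
      unfolding yr graph_pt_def using norm_fst_le by (metis diff_Pair fst_conv)
    then have "norm (y - x) < d" "dist y x < d2" using z(2) by (simp_all add: dist_norm)
    with d d2 have 1: "\<bar>f y\<bar> \<noteq> \<infinity>" "\<bar>F y - F x - (y - x) \<bullet> g\<bar> \<le> e * norm (y - x)" by auto
    have "F y \<le> r" using z(1) 1(1) by (auto simp: epi_def yr F_def ereal_real real_le_ereal_iff)
    then have "(g, -1) \<bullet> (z - graph_pt f x) \<le> e * norm (y - x)"
      using 1(2) by (simp add: yr graph_pt_def inner_prod_def F_def inner_commute)
    also have "\<dots> \<le> e * norm (z - graph_pt f x)" using nle e by simp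
    finally show ?thesis .
  qed
  then show "\<exists>d>0. \<forall>z\<in>epi f. dist z (graph_pt f x) < d \<longrightarrow>
      (g, -1) \<bullet> (z - graph_pt f x) \<le> e * norm (z - graph_pt f x)"
    using d(1) d2(1) by (intro exI[of _ "min d d2"]) simp
qed

lemma has_egradient_C2_piece:
  fixes f :: "'a::real_inner \<Rightarrow> ereal"
  assumes "open V" "y \<in> V" "\<And>y. y \<in> V \<Longrightarrow> f y = ereal (g y)" "GDERIV g y :> v"
  shows "has_egradient f y v"
  unfolding has_egradient_def
proof
  show "\<forall>\<^sub>F y in nhds y. \<bar>f y\<bar> \<noteq> \<infinity>"
    unfolding eventually_nhds using assms(1-3) by (intro exI[of _ V]) auto
  show "GDERIV (\<lambda>y. real_of_ereal (f y)) y :> v"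
    using assms(4) unfolding gderiv_def
    by (rule has_derivative_transform_within_open[OF _ assms(1,2)]) (simp add: assms(3))
qed

section \<open>The cone generated by limits of gradients and normals to the domain\<close>

text \<open>Base points are recorded on the graph, so that closure enforces convergence of the
  values of \<open>f\<close> as well as of the points. The free factor \<open>c\<close> lets a
  single closure produce limits of gradients and limits of gradients scaled to 0 alike.\<close>

definition gradient_normals :: "('a::real_inner \<Rightarrow> ereal) \<Rightarrow> 'a set \<Rightarrow> (('a \<times> real) \<times> ('a \<times> real)) set" where
  "gradient_normals f \<Omega> =
     {(graph_pt f x, c *\<^sub>R (g, -1)) | x g c. x \<in> \<Omega> \<and> has_egradient f x g \<and> 0 \<le> c}"

text \<open>A closed cone whose convex conical hull is the \<open>K(x)\<close> of the
  overview.\<close>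

definition generators :: "('a::real_inner \<Rightarrow> ereal) \<Rightarrow> 'a set \<Rightarrow> 'a \<Rightarrow> ('a \<times> real) set" where
  "generators f \<Omega> x = {w. (graph_pt f x, w) \<in> closure (gradient_normals f \<Omega>)}
     \<union> limiting_normal_cone (edom f) x \<times> {0}"

lemma closed_generators: "closed (generators f \<Omega> x)"
  unfolding generators_def
  by (intro closed_Un closed_section closed_Times closed_limiting_normal_cone) auto

lemma generators_scaleR:
  assumes "w \<in> generators f \<Omega> x" "0 \<le> c"
  shows "c *\<^sub>R w \<in> generators f \<Omega> x"
proof -
  have "(graph_pt f x, c *\<^sub>R w) \<in> closure (gradient_normals f \<Omega>)"
    if w: "(graph_pt f x, w) \<in> closure (gradient_normals f \<Omega>)"
  proof -
    let ?h = "\<lambda>p::('a \<times> real) \<times> 'a \<times> real. (fst p, c *\<^sub>R snd p)"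
    have "?h ` closure (gradient_normals f \<Omega>) \<subseteq> closure (gradient_normals f \<Omega>)"
    proof (rule image_closure_subset)
      show "continuous_on (closure (gradient_normals f \<Omega>)) ?h" by (intro continuous_intros)
      have "?h ` gradient_normals f \<Omega> \<subseteq> gradient_normals f \<Omega>"
      proof
        fix q assume "q \<in> ?h ` gradient_normals f \<Omega>"
        then obtain y g b where "y \<in> \<Omega>" "has_egradient f y g" "0 \<le> b"
          "q = (graph_pt f y, (c * b) *\<^sub>R (g, -1))" unfolding gradient_normals_def by fastforce
        with assms(2) show "q \<in> gradient_normals f \<Omega>"
          unfolding gradient_normals_def by (smt (verit) mem_Collect_eq mult_nonneg_nonneg)
      qed
      then show "?h ` gradient_normals f \<Omega> \<subseteq> closure (gradient_normals f \<Omega>)"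
        using closure_subset by blast
    qed simp
    with w show ?thesis by force
  qed
  moreover have "c *\<^sub>R w \<in> limiting_normal_cone (edom f) x \<times> {0}"
    if "w \<in> limiting_normal_cone (edom f) x \<times> {0}"
    using that limiting_normal_cone_scaleR[OF _ assms(2)] by auto
  ultimately show ?thesis using assms(1) unfolding generators_def by blast
qed

lemma subseq_cases:
  fixes A B :: "nat \<Rightarrow> bool"
  assumes "\<And>i. A i \<or> B i"
  shows "(\<exists>r. strict_mono (r :: nat \<Rightarrow> nat) \<and> (\<forall>i. A (r i))) \<or>
         (\<exists>r. strict_mono (r :: nat \<Rightarrow> nat) \<and> (\<forall>i. B (r i)))"
proof -
  have sub: "\<exists>r. strict_mono (r :: nat \<Rightarrow> nat) \<and> (\<forall>i. P (r i))" if "infinite {i. P i}" for P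
    using strict_mono_enumerate[OF that] enumerate_in_set[OF that] by blast
  have "UNIV = {i. A i} \<union> {i. B i}" using assms by blast
  then have "infinite {i. A i} \<or> infinite {i. B i}" by (metis finite_UnI infinite_UNIV_nat)
  then show ?thesis using sub[of A] sub[of B] by blast
qed

text \<open>Both kinds of generators have closed graphs, and a subsequence stays within one kind.
  Convergence is required of graph points, not merely of base points, since \<open>f\<close> need
  not be continuous.\<close>

lemma generators_osc:
  assumes X: "(\<lambda>i. graph_pt f (X i)) \<longlonglongrightarrow> graph_pt f x" and w: "\<And>i::nat. W i \<in> generators f \<Omega> (X i)"
    and W: "W \<longlonglongrightarrow> l"
  shows "l \<in> generators f \<Omega> x"
proof -
  define A where "A i \<longleftrightarrow> (graph_pt f (X i), W i) \<in> closure (gradient_normals f \<Omega>)" for i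
  define B where "B i \<longleftrightarrow> W i \<in> limiting_normal_cone (edom f) (X i) \<times> {0}" for i
  have AB: "A i \<or> B i" for i using w[of i] unfolding generators_def A_def B_def by blast
  from subseq_cases[of A B, OF AB]
  consider r :: "nat \<Rightarrow> nat" where "strict_mono r" "\<And>i. A (r i)"
    | r :: "nat \<Rightarrow> nat" where "strict_mono r" "\<And>i. B (r i)" by blast
  then show ?thesis
  proof cases
    case 1
    have "(\<lambda>i. (graph_pt f (X (r i)), W (r i))) \<longlonglongrightarrow> (graph_pt f x, l)"
      using LIMSEQ_subseq_LIMSEQ[OF X 1(1)] LIMSEQ_subseq_LIMSEQ[OF W 1(1)]
      by (intro tendsto_Pair) (simp_all add: o_def)
    from closed_sequentially[OF closed_closure 1(2)[unfolded A_def] this] show ?thesis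
      unfolding generators_def by blast
  next
    case 2
    have Wr: "(\<lambda>i. W (r i)) \<longlonglongrightarrow> l" using LIMSEQ_subseq_LIMSEQ[OF W 2(1)] by (simp add: o_def)
    have "(\<lambda>i. X (r i)) \<longlonglongrightarrow> x"
      using tendsto_fst[OF LIMSEQ_subseq_LIMSEQ[OF X 2(1)]] by (simp add: o_def graph_pt_def)
    then have "fst l \<in> limiting_normal_cone (edom f) x"
      using limiting_normal_cone_osc[OF _ tendsto_fst[OF Wr]] 2(2) unfolding B_def by (auto simp: mem_Times_iff)
    moreover have "snd (W (r i)) = 0" for i using 2(2)[of i] unfolding B_def by auto
    then have "snd l = 0" using tendsto_snd[OF Wr] by (simp add: LIMSEQ_const_iff)
    ultimately show ?thesis unfolding generators_def by (simp add: mem_Times_iff)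
  qed
qed

section \<open>Epigraphs regular over an open set: pointedness and limits of normals\<close>

locale regular_epigraph =
  fixes f :: "'a::euclidean_space \<Rightarrow> ereal" and \<Omega> U :: "'a set"
  assumes proper: "proper_fun f" and open_U: "open U"
    and regular: "\<And>y. y \<in> U \<Longrightarrow> y \<in> edom f \<Longrightarrow> vertically_continuous f y \<and> directionally_lipschitzian f y"
    and Omega: "\<Omega> \<subseteq> edom f" "edom f \<subseteq> closure \<Omega>"
begin

lemma finite_on_edom: "x \<in> edom f \<Longrightarrow> \<bar>f x\<bar> \<noteq> \<infinity>"
  using proper by (auto simp: proper_fun_def edom_def)

lemma ereal_real_edom: "x \<in> edom f \<Longrightarrow> ereal (real_of_ereal (f x)) = f x"
  using finite_on_edom by (simp add: ereal_real)

lemma epi_imp_edom: "z \<in> epi f \<Longrightarrow> fst z \<in> edom f"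
  by (auto simp: epi_def edom_def)

text \<open>Vertical continuity read from right to left: normals to the domain are limits of normals
  at points strictly above the graph. This brings them under the pointedness hypothesis.\<close>

lemma dom_normals_subset:
  assumes "x \<in> U" "x \<in> edom f"
  shows "limiting_normal_cone (edom f) x \<times> {0::real} \<subseteq> limiting_normal_cone (epi f) (graph_pt f x)"
proof
  fix w assume "w \<in> limiting_normal_cone (edom f) x \<times> {0::real}"
  then obtain X R W where XR: "\<And>i::nat. W i \<in> limiting_normal_cone (epi f) (X i, R i)"
    "X \<longlonglongrightarrow> x" "(\<lambda>i. ereal (R i)) \<longlonglongrightarrow> f x" "W \<longlonglongrightarrow> w"
    using regular[OF assms] unfolding vertically_continuous_def by blast
  have "R \<longlonglongrightarrow> real_of_ereal (f x)"
    using XR(3) ereal_real_edom[OF assms(2)] by (metis lim_ereal)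
  then have "(\<lambda>i. (X i, R i)) \<longlonglongrightarrow> graph_pt f x"
    unfolding graph_pt_def by (intro tendsto_Pair XR(2))
  from limiting_normal_cone_osc[OF this XR(4,1)]
  show "w \<in> limiting_normal_cone (epi f) (graph_pt f x)" .
qed

lemma gradient_normals_subset:
  "gradient_normals f \<Omega> \<subseteq> {(y, w). y \<in> epi f \<and> w \<in> frechet_normal_cone (epi f) y}"
proof
  fix p assume "p \<in> gradient_normals f \<Omega>"
  then obtain x g c where p: "p = (graph_pt f x, c *\<^sub>R (g, -1))" "x \<in> \<Omega>" "has_egradient f x g" "0 \<le> c"
    unfolding gradient_normals_def by blast
  have "graph_pt f x \<in> epi f" using p(2) Omega(1) by (intro graph_pt_in_epi finite_on_edom) auto
  moreover have "c *\<^sub>R (g, -1) \<in> frechet_normal_cone (epi f) (graph_pt f x)"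
    by (rule convex_cone_scaleR[OF convex_cone_frechet_normal_cone p(4)
          gradient_in_frechet_normal_cone[OF p(3)]])
  ultimately show "p \<in> {(y, w). y \<in> epi f \<and> w \<in> frechet_normal_cone (epi f) y}"
    by (simp add: p(1))
qed

lemma generators_subset:
  assumes "x \<in> U" "x \<in> edom f"
  shows "generators f \<Omega> x \<subseteq> limiting_normal_cone (epi f) (graph_pt f x)"
  using dom_normals_subset[OF assms] closure_mono[OF gradient_normals_subset]
  unfolding generators_def limiting_normal_cone_closure[of "epi f"] by blast

text \<open>Last coordinates of normals are nonpositive, so in a vanishing sum they are all 0. Every
  summand is then horizontal, and pointedness of the horizon subdifferential applies to the whole
  normal cone.\<close>

lemma horizon_pointed:
  assumes "x \<in> U" "x \<in> edom f"
    and "\<And>i. i < m \<Longrightarrow> v i \<in> limiting_normal_cone (epi f) (graph_pt f x)"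
    and sum: "(\<Sum>i<m. v i) = 0" and i: "i < (m::nat)"
  shows "v i = 0"
proof -
  have le: "snd (v i) \<le> 0" if "i < m" for i
    using assms(3)[OF that] by (rule limiting_normal_epi_snd)
  have "(\<Sum>i<m. snd (v i)) = snd (\<Sum>i<m. v i)" by (rule snd_sum[symmetric])
  then have "(\<Sum>i<m. - snd (v i)) = 0" using sum by (simp add: sum_negf)
  then have snd0: "snd (v i) = 0" if "i < m" for i
    using sum_nonneg_eq_0_iff[of "{..<m}" "\<lambda>i. - snd (v i)"] le that by auto
  have "fst (v i) \<in> horizon_subdiff f x" if "i < m" for i
    using assms(3)[OF that] snd0[OF that] unfolding horizon_subdiff_def graph_pt_def
    by (metis mem_Collect_eq prod.collapse)
  moreover have "(\<Sum>i<m. fst (v i)) = 0" using fst_sum[of v "{..<m}"] sum by simp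
  moreover have "pointed_cone (horizon_subdiff f x)"
    using regular[OF assms(1,2)] by (simp add: directionally_lipschitzian_def)
  ultimately have "fst (v i) = 0"
    unfolding pointed_cone_def using i by (metis (mono_tags, lifting))
  with snd0[OF i] show ?thesis by (simp add: prod_eq_iff)
qed

lemma generators_pointed:
  assumes "x \<in> U" "x \<in> edom f"
  shows "0 \<notin> convex hull (generators f \<Omega> x \<inter> sphere 0 1)"
proof
  assume "0 \<in> convex hull (generators f \<Omega> x \<inter> sphere 0 1)"
  then obtain k u p where p: "\<And>i. i \<in> {1::nat..k} \<Longrightarrow> 0 \<le> u i \<and> p i \<in> generators f \<Omega> x \<inter> sphere 0 1"
    "sum u {1..k} = 1" "(\<Sum>i=1..k. u i *\<^sub>R p i) = 0"
    unfolding convex_hull_indexed by (smt (verit) mem_Collect_eq)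
  \<comment> \<open>\<open>convex_hull_indexed\<close> counts from 1, \<open>pointed_cone\<close>
    from 0; hence the shift by \<open>Suc\<close>.\<close>
  define v where "v i = u (Suc i) *\<^sub>R p (Suc i)" for i
  have shift: "{1..k} = Suc ` {..<k}" by (simp add: lessThan_atLeast0 image_Suc_atLeastLessThan atLeastLessThanSuc_atLeastAtMost)
  have "(\<Sum>i<k. v i) = 0" using p(3) unfolding shift by (simp add: sum.reindex v_def)
  moreover have "v i \<in> limiting_normal_cone (epi f) (graph_pt f x)" if "i < k" for i
    unfolding v_def using p(1)[of "Suc i"] that generators_subset[OF assms]
    by (intro limiting_normal_cone_scaleR) auto
  ultimately have "v i = 0" if "i < k" for i
    using horizon_pointed[OF assms, of k v i] that by blast
  then have "u (Suc i) = 0" if "i < k" for i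
    using p(1)[of "Suc i"] that unfolding v_def by fastforce
  then have "sum u {1..k} = 0" unfolding shift by (simp add: sum.reindex)
  with p(2) show False by simp
qed

text \<open>A subsequence lies strictly above the graph or on it. Above, vertical continuity read
  from left to right makes the limit a normal to the domain; on the graph, outer semicontinuity of
  the hulls applies.\<close>

lemma limit_in_hull:
  assumes x: "x \<in> U" "x \<in> edom f"
    and Y: "\<And>i::nat. Y i \<in> epi f" "Y \<longlonglongrightarrow> graph_pt f x"
    and W: "\<And>i. W i \<in> frechet_normal_cone (epi f) (Y i)" "W \<longlonglongrightarrow> w"
    and hull: "\<And>i. Y i = graph_pt f (fst (Y i)) \<Longrightarrow> W i \<in> convex_cone hull (generators f \<Omega> (fst (Y i)))"
  shows "w \<in> convex_cone hull (generators f \<Omega> x)"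
proof -
  define A where "A i \<longleftrightarrow> f (fst (Y i)) < ereal (snd (Y i))" for i
  define B where "B i \<longleftrightarrow> Y i = graph_pt f (fst (Y i))" for i
  have AB: "A i \<or> B i" for i
  proof -
    have "f (fst (Y i)) \<le> ereal (snd (Y i))" using Y(1)[of i] by (auto simp: epi_def)
    moreover have "snd (Y i) = real_of_ereal (f (fst (Y i)))" if "f (fst (Y i)) = ereal (snd (Y i))"
      using that by simp
    ultimately show ?thesis unfolding A_def B_def graph_pt_def by (metis le_less prod.collapse)
  qed
  from subseq_cases[of A B, OF AB]
  consider r :: "nat \<Rightarrow> nat" where "strict_mono r" "\<And>i. A (r i)"
    | r :: "nat \<Rightarrow> nat" where "strict_mono r" "\<And>i. B (r i)" by blast
  then show ?thesis
  proof cases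
    case 1
    have Yr: "(\<lambda>i. Y (r i)) \<longlonglongrightarrow> graph_pt f x" and Wr: "(\<lambda>i. W (r i)) \<longlonglongrightarrow> w"
      using LIMSEQ_subseq_LIMSEQ[OF Y(2) 1(1)] LIMSEQ_subseq_LIMSEQ[OF W(2) 1(1)] by (simp_all add: o_def)
    let ?S = "{w. \<exists>X R W. (\<forall>i::nat. f (X i) < ereal (R i) \<and> W i \<in> limiting_normal_cone (epi f) (X i, R i)) \<and>
           X \<longlonglongrightarrow> x \<and> (\<lambda>i. ereal (R i)) \<longlonglongrightarrow> f x \<and> W \<longlonglongrightarrow> w}"
    have "w \<in> ?S"
    proof (intro CollectI exI conjI allI)
      fix i
      show "f (fst (Y (r i))) < ereal (snd (Y (r i)))" using 1(2) by (simp add: A_def)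
      show "W (r i) \<in> limiting_normal_cone (epi f) (fst (Y (r i)), snd (Y (r i)))"
        using frechet_subset_limiting_normal_cone[OF Y(1)] W(1) by auto
    next
      show "(\<lambda>i. fst (Y (r i))) \<longlonglongrightarrow> x" using tendsto_fst[OF Yr] by (simp add: graph_pt_def)
      have "(\<lambda>i. ereal (snd (Y (r i)))) \<longlonglongrightarrow> ereal (real_of_ereal (f x))"
        using tendsto_snd[OF Yr] by (intro tendsto_ereal) (simp add: graph_pt_def)
      then show "(\<lambda>i. ereal (snd (Y (r i)))) \<longlonglongrightarrow> f x" by (simp add: ereal_real_edom[OF x(2)])
    qed (rule Wr)
    also have "?S = limiting_normal_cone (edom f) x \<times> {0}"
      using regular[OF x] unfolding vertically_continuous_def by blast
    finally have "w \<in> generators f \<Omega> x" unfolding generators_def by blast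
    then show ?thesis by (rule hull_inc)
  next
    case 2
    define S where "S i = generators f \<Omega> (fst (Y (r i)))" for i
    show ?thesis
    proof (rule convex_cone_hull_osc[where S = S and W = "\<lambda>i. W (r i)"])
      show "W (r i) \<in> convex_cone hull S i" for i
        unfolding S_def using hull 2(2) by (simp add: B_def)
      show "(\<lambda>i. W (r i)) \<longlonglongrightarrow> w"
        using LIMSEQ_subseq_LIMSEQ[OF W(2) 2(1)] by (simp add: o_def)
      fix s :: "nat \<Rightarrow> nat" and g l assume s: "strict_mono s" "\<And>i. g i \<in> S (s i)" "g \<longlonglongrightarrow> l"
      show "l \<in> generators f \<Omega> x"
      proof (rule generators_osc[OF _ s(2)[unfolded S_def] s(3)])
        have "(\<lambda>i. Y (r (s i))) \<longlonglongrightarrow> graph_pt f x"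
          using LIMSEQ_subseq_LIMSEQ[OF LIMSEQ_subseq_LIMSEQ[OF Y(2) 2(1)] s(1)] by (simp add: o_def)
        moreover have "graph_pt f (fst (Y (r (s i)))) = Y (r (s i))" for i
          using 2(2) by (simp add: B_def)
        ultimately show "(\<lambda>i. graph_pt f (fst (Y (r (s i))))) \<longlonglongrightarrow> graph_pt f x" by simp
      qed
    qed (use closed_generators generators_scaleR generators_pointed[OF x] in \<open>auto simp: S_def\<close>)
  qed
qed

section \<open>Frechet normals at graph points over strata\<close>

lemma open_stratum_normals:
  assumes x: "x \<in> edom f" and V: "open V" "x \<in> V" "\<And>y. y \<in> V \<Longrightarrow> f y = ereal (g y)"
    and grad: "\<And>y. GDERIV g y :> grad y" "continuous_on UNIV grad"
  shows "frechet_normal_cone (epi f) (graph_pt f x) \<subseteq> generators f \<Omega> x"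
proof
  fix w assume w: "w \<in> frechet_normal_cone (epi f) (graph_pt f x)"
  have gp: "graph_pt f y = (y, g y)" if "y \<in> V" for y using V(3)[OF that] by (simp add: graph_pt_def)
  have "(fst w + snd w *\<^sub>R grad x) \<bullet> t \<le> 0" for t
  proof (rule frechet_normal_epi_curve[where \<gamma> = "\<lambda>s. x + s *\<^sub>R t"])
    show "w \<in> frechet_normal_cone (epi f) (x, g x)" using w gp[OF V(2)] by simp
    show "((\<lambda>s. x + s *\<^sub>R t) has_vector_derivative t) (at 0)"
      by (auto intro!: derivative_eq_intros)
    have "((\<lambda>s. x + s *\<^sub>R t) \<longlongrightarrow> x + 0 *\<^sub>R t) (nhds 0)" by (intro tendsto_intros filterlim_ident)
    then have "\<forall>\<^sub>F s in nhds 0. x + s *\<^sub>R t \<in> V" using topological_tendstoD[of _ _ _ V] V by simp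
    then show "\<forall>\<^sub>F s in nhds 0. f (x + s *\<^sub>R t) = ereal (g (x + s *\<^sub>R t))"
      by eventually_elim (rule V(3))
  qed (simp_all add: grad)
  \<comment> \<open>Every direction is admissible, in particular the vector itself, whose squared
    norm is therefore nonpositive.\<close>
  from this[of "fst w + snd w *\<^sub>R grad x"] have eq0: "fst w + snd w *\<^sub>R grad x = 0"
    by (metis inner_eq_zero_iff inner_ge_zero order_antisym)
  define c where "c = - snd w"
  have weq: "w = c *\<^sub>R (grad x, -1)"
    using eq0 by (simp add: prod_eq_iff c_def add_eq_0_iff2)
  have "graph_pt f x \<in> epi f" using x finite_on_edom graph_pt_in_epi by metis
  then have c: "c \<ge> 0" using frechet_normal_epi_snd[OF w] by (simp add: c_def)
  \<comment> \<open>The point \<open>x\<close> itself need not be in \<open>\<Omega>\<close>.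
    Density supplies nearby points of \<open>\<Omega>\<close>, and continuity of \<open>g\<close>
    and \<open>grad\<close> carries their graph points and normals to those at
    \<open>x\<close>.\<close>
  obtain Y where Y: "\<And>i::nat. Y i \<in> \<Omega>" "Y \<longlonglongrightarrow> x"
    using x Omega(2) unfolding closure_sequential by (metis closure_sequential subsetD)
  have "\<forall>\<^sub>F i in sequentially. Y i \<in> V" using topological_tendstoD[OF Y(2) V(1,2)] .
  then have "\<forall>\<^sub>F i in sequentially. ((Y i, g (Y i)), c *\<^sub>R (grad (Y i), -1)) \<in> closure (gradient_normals f \<Omega>)"
  proof eventually_elim
    case (elim i)
    have "has_egradient f (Y i) (grad (Y i))"
      by (rule has_egradient_C2_piece[OF V(1) elim V(3) grad(1)])
    then have "(graph_pt f (Y i), c *\<^sub>R (grad (Y i), -1)) \<in> gradient_normals f \<Omega>"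
      unfolding gradient_normals_def using Y(1) c by blast
    with gp[OF elim] show ?case using closure_subset by (metis subsetD)
  qed
  moreover have "isCont g x" using grad(1) has_derivative_continuous unfolding gderiv_def by blast
  moreover have "isCont grad x" using grad(2) continuous_on_eq_continuous_at open_UNIV by blast
  ultimately have "((x, g x), c *\<^sub>R (grad x, -1)) \<in> closure (gradient_normals f \<Omega>)"
    using Y(2) by (intro Lim_in_closed_set[OF closed_closure])
      (auto intro!: tendsto_intros isCont_tendsto_compose[of x g] isCont_tendsto_compose[of x grad])
  then show "w \<in> generators f \<Omega> x" unfolding generators_def gp[OF V(2)] weq by blast
qed

lemma stratum_normals:
  assumes x: "x \<in> U" "x \<in> edom f"
    and M: "C2_submanifold M" "C2_smooth_on_stratum f M" "x \<in> M"
    and \<delta>: "\<delta> > 0" and off: "\<And>y. y \<in> U \<Longrightarrow> y \<in> edom f \<Longrightarrow> y \<notin> M \<Longrightarrow> dist y x < \<delta> \<Longrightarrow>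
        frechet_normal_cone (epi f) (graph_pt f y) \<subseteq> convex_cone hull (generators f \<Omega> y)"
  shows "frechet_normal_cone (epi f) (graph_pt f x) \<subseteq> convex_cone hull (generators f \<Omega> x)"
proof -
  let ?C = "frechet_normal_cone (epi f) (graph_pt f x)"
  have zQ: "graph_pt f x \<in> epi f" using x(2) finite_on_edom graph_pt_in_epi by metis
  obtain O' and g :: "'a \<Rightarrow> real" where O': "open O'" "x \<in> O'" "C2_on g UNIV"
    "\<And>y. y \<in> M \<inter> O' \<Longrightarrow> f y = ereal (g y)"
    using M(2,3) unfolding C2_smooth_on_stratum_def by metis
  obtain grad where grad: "\<And>x. GDERIV g x :> grad x" "continuous_on UNIV grad"
    "\<And>x. \<exists>C d. d > 0 \<and> (\<forall>y. dist y x < d \<longrightarrow> \<bar>g y - g x - grad x \<bullet> (y - x)\<bar> \<le> C * (norm (y - x))\<^sup>2)"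
    using C2_gradient[OF O'(3)] by metis
  have gp: "graph_pt f y = (y, g y)" if "y \<in> M" "y \<in> O'" for y
    using O'(4)[of y] that by (simp add: graph_pt_def)
  from M(1,3) show ?thesis
  proof (cases rule: C2_submanifold_tangent)
    case (full V)
    have "?C \<subseteq> generators f \<Omega> x"
      by (rule open_stratum_normals[OF x(2), of "V \<inter> O'" g grad])
        (use full O' grad in \<open>auto simp: subset_iff\<close>)
    also have "\<dots> \<subseteq> convex_cone hull (generators f \<Omega> x)" by (rule hull_subset)
    finally show ?thesis .
  next
    case (proper T)
    \<comment> \<open>The normal space at \<open>x\<close> of the graph of \<open>f\<close> over
      \<open>M\<close>: the vectors orthogonal to all lifted tangents
      \<open>(t, t \<bullet> grad x)\<close>.\<close>
    define L where "L = {b. \<forall>t\<in>T. (fst b + snd b *\<^sub>R grad x) \<bullet> t = 0}"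
    have L: "subspace L"
      unfolding subspace_def
    proof (intro conjI ballI allI)
      show "0 \<in> L" by (simp add: L_def)
    next
      fix a b assume a: "a \<in> L" and b: "b \<in> L"
      show "a + b \<in> L"
        unfolding L_def
      proof (intro CollectI ballI)
        fix t assume t: "t \<in> T"
        have "(fst (a + b) + snd (a + b) *\<^sub>R grad x) \<bullet> t
            = (fst a + snd a *\<^sub>R grad x) \<bullet> t + (fst b + snd b *\<^sub>R grad x) \<bullet> t"
          by (simp add: inner_add_left algebra_simps)
        then show "(fst (a + b) + snd (a + b) *\<^sub>R grad x) \<bullet> t = 0"
          using a b t by (simp add: L_def)
      qed
    next
      fix c :: real and a assume a: "a \<in> L"
      have "(fst (c *\<^sub>R a) + snd (c *\<^sub>R a) *\<^sub>R grad x) \<bullet> t = c * ((fst a + snd a *\<^sub>R grad x) \<bullet> t)" for t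
        by (simp add: inner_add_left algebra_simps)
      with a show "c *\<^sub>R a \<in> L" by (simp add: L_def)
    qed
    have CL: "?C \<subseteq> L"
    proof
      fix w assume w: "w \<in> ?C"
      have le: "(fst w + snd w *\<^sub>R grad x) \<bullet> t \<le> 0" if "t \<in> T" for t
      proof -
        from proper(3)[OF that] obtain \<gamma> where \<gamma>: "(\<gamma> has_vector_derivative t) (at 0)" "\<gamma> 0 = x"
          "\<forall>\<^sub>F s in nhds (0::real). \<gamma> s \<in> M" by blast
        show ?thesis
        proof (rule frechet_normal_epi_curve[OF _ \<gamma>(1,2) _ grad(1)])
          show "w \<in> frechet_normal_cone (epi f) (x, g x)" using w gp[OF M(3) O'(2)] by simp
          have "(\<gamma> \<longlongrightarrow> x) (nhds 0)"
            using has_vector_derivative_continuous[OF \<gamma>(1)] \<gamma>(2)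
            by (metis continuous_at tendsto_nhds_iff)
          then have "\<forall>\<^sub>F s in nhds 0. \<gamma> s \<in> O'" using topological_tendstoD O'(1,2) by blast
          with \<gamma>(3) show "\<forall>\<^sub>F s in nhds 0. f (\<gamma> s) = ereal (g (\<gamma> s))"
            by eventually_elim (use O'(4) in auto)
        qed
      qed
      \<comment> \<open>\<open>T\<close> is a subspace, so the inequality holds for \<open>t\<close>
        and for its negative.\<close>
      have "(fst w + snd w *\<^sub>R grad x) \<bullet> t = 0" if "t \<in> T" for t
        using le[OF that] le[OF subspace_neg[OF proper(1) that]] by simp
      then show "w \<in> L" by (simp add: L_def)
    qed
    have "dim T < DIM('a)"
      using proper(1,2) dim_eq_full[of T] dim_subset_UNIV[of T] span_eq_iff by (metis order_le_less)
    then obtain e where e: "e \<noteq> 0" "\<And>t. t \<in> T \<Longrightarrow> e \<bullet> t = 0"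
      using orthogonal_to_subspace_exists[of T] by (metis orthogonal_def span_base)
    have eL: "(e, 0) \<in> L" "(- e, 0) \<in> L" using e(2) by (auto simp: L_def)
    \<comment> \<open>With both present, the pair would be a nontrivial family of normals with sum
      0.\<close>
    have "(e, 0) \<notin> ?C \<or> - (e, 0) \<notin> ?C"
    proof (rule ccontr)
      assume "\<not> ?thesis"
      then have "(e, 0::real) \<in> ?C" "(- e, 0) \<in> ?C" by auto
      then have N: "(e, 0::real) \<in> limiting_normal_cone (epi f) (graph_pt f x)"
        "(- e, 0::real) \<in> limiting_normal_cone (epi f) (graph_pt f x)"
        using frechet_subset_limiting_normal_cone[OF zQ] by auto
      define v where "v i = (if i = (0::nat) then (e, 0::real) else (- e, 0))" for i
      have "v 0 = 0"
        by (rule horizon_pointed[OF x, where m = 2 and v = v])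
          (use N in \<open>auto simp: v_def numeral_2_eq_2 zero_prod_def\<close>)
      with e(1) show False by (simp add: v_def zero_prod_def)
    qed
    moreover have bdry: "b \<in> boundary_in L ?C" if b: "b \<in> ?C" "b \<in> L" "snd b = 0" for b
      unfolding boundary_in_def
    proof (intro CollectI conjI allI impI b)
      fix \<eta> :: real assume \<eta>: "\<eta> > 0"
      define n where "n = norm (- grad x, 1::real)"
      have n: "n > 0" by (simp add: n_def zero_prod_def)
      \<comment> \<open>A step of length \<open>\<eta> / 2\<close> along the upward normal
        \<open>(- grad x, 1)\<close>, which is in \<open>L\<close>. It raises the last coordinate
        from 0 to a positive value, and no Frechet normal has one.\<close>
      define b' where "b' = b + (\<eta> / (2 * n)) *\<^sub>R (- grad x, 1)"
      have "(- grad x, 1) \<in> L" by (simp add: L_def)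
      then have "b' \<in> L" unfolding b'_def by (intro subspace_add subspace_scale L b(2))
      moreover have "dist b' b < \<eta>" using \<eta> n
        by (simp add: b'_def dist_norm n_def[symmetric] del: scaleR_Pair)
      moreover have "snd b' > 0" using \<eta> n b(3) by (simp add: b'_def)
      then have "b' \<notin> ?C" using frechet_normal_epi_snd[OF _ zQ] by (metis not_le)
      ultimately show "\<exists>b'\<in>L. dist b' b < \<eta> \<and> b' \<notin> ?C" by blast
    qed
    ultimately have "?C \<subseteq> convex_cone hull (boundary_in L ?C)"
      using eL by (intro convex_cone_boundary_decomposition[where u = "(e, 0)"]
          closed_frechet_normal_cone convex_cone_frechet_normal_cone L CL) auto
    also have "\<dots> \<subseteq> convex_cone hull (generators f \<Omega> x)"
    proof (rule hull_minimal, rule subsetI)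
      show "convex_cone (convex_cone hull (generators f \<Omega> x))" by (rule convex_cone_convex_cone_hull)
      fix b assume b: "b \<in> boundary_in L ?C"
      obtain C2 d2 where 2: "d2 > 0"
        "\<And>y. dist y x < d2 \<Longrightarrow> \<bar>g y - g x - grad x \<bullet> (y - x)\<bar> \<le> C2 * (norm (y - x))\<^sup>2"
        using grad(3)[of x] by blast
      obtain d3 where d3: "d3 > 0" "ball x d3 \<subseteq> O'" using O'(1,2) open_contains_ball by blast
      \<comment> \<open>The product with \<open>b'\<close> splits into a part controlled by
        orthogonality to \<open>T\<close> and \<open>snd b'\<close> times the Taylor remainder of
        \<open>g\<close>; both are quadratic. So vectors of \<open>L\<close> are proximal normals to
        the graph over \<open>M\<close>, as the projection argument requires.\<close>
      have prox: "\<exists>C d. d > 0 \<and> (\<forall>p\<in>graph_pt f ` M. dist p (graph_pt f x) < d \<longrightarrow>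
          b' \<bullet> (p - graph_pt f x) \<le> C * (norm (p - graph_pt f x))\<^sup>2)" if b': "b' \<in> L" for b'
      proof -
        obtain C1 d1 where 1: "d1 > 0" "\<And>y. y \<in> M \<Longrightarrow> dist y x < d1 \<Longrightarrow>
            (fst b' + snd b' *\<^sub>R grad x) \<bullet> (y - x) \<le> C1 * (norm (y - x))\<^sup>2"
          using proper(4)[of "fst b' + snd b' *\<^sub>R grad x"] b' unfolding L_def by blast
        \<comment> \<open>The absolute values make \<open>C\<close> nonnegative, so that
          \<open>norm (y - x)\<close> may be replaced by the larger distance of the graph
          points.\<close>
        define C where "C = \<bar>C1\<bar> + \<bar>snd b'\<bar> * \<bar>C2\<bar>"
        have "b' \<bullet> (graph_pt f y - graph_pt f x) \<le> C * (norm (graph_pt f y - graph_pt f x))\<^sup>2"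
          if y: "y \<in> M" "dist (graph_pt f y) (graph_pt f x) < min d1 (min d2 d3)" for y
        proof -
          have nle: "norm (y - x) \<le> norm (graph_pt f y - graph_pt f x)"
            unfolding graph_pt_def using norm_fst_le by (metis diff_Pair fst_conv)
          then have yd: "dist y x < d1" "dist y x < d2" "dist y x < d3"
            using y(2) by (simp_all add: dist_norm)
          then have yO: "y \<in> O'" using d3 by (auto simp: dist_commute)
          let ?r = "g y - g x - grad x \<bullet> (y - x)"
          have "b' \<bullet> (graph_pt f y - graph_pt f x) =
              (fst b' + snd b' *\<^sub>R grad x) \<bullet> (y - x) + snd b' * ?r"
            using gp[OF y(1) yO] gp[OF M(3) O'(2)]
            by (simp add: inner_prod_def inner_add_left algebra_simps)
          also have "(fst b' + snd b' *\<^sub>R grad x) \<bullet> (y - x) \<le> \<bar>C1\<bar> * (norm (y - x))\<^sup>2"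
            by (rule order_trans[OF 1(2)[OF y(1) yd(1)]]) (intro mult_right_mono, auto)
          also have "snd b' * ?r \<le> \<bar>snd b'\<bar> * (\<bar>C2\<bar> * (norm (y - x))\<^sup>2)"
          proof -
            have "\<bar>?r\<bar> \<le> \<bar>C2\<bar> * (norm (y - x))\<^sup>2"
              by (rule order_trans[OF 2(2)[OF yd(2)]]) (intro mult_right_mono, auto)
            then have "\<bar>snd b' * ?r\<bar> \<le> \<bar>snd b'\<bar> * (\<bar>C2\<bar> * (norm (y - x))\<^sup>2)"
              unfolding abs_mult[of "snd b'"] by (intro mult_left_mono) auto
            then show ?thesis by linarith
          qed
          finally have "b' \<bullet> (graph_pt f y - graph_pt f x) \<le> C * (norm (y - x))\<^sup>2"
            by (simp add: C_def distrib_right mult.assoc)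
          also have "\<dots> \<le> C * (norm (graph_pt f y - graph_pt f x))\<^sup>2"
            using nle by (intro mult_left_mono power_mono) (auto simp: C_def)
          finally show ?thesis .
        qed
        then show ?thesis using 1(1) 2(1) d3(1)
          by (intro exI[of _ C] exI[of _ "min d1 (min d2 d3)"]) auto
      qed
      have lc: "locally_closed_at (epi f) (graph_pt f x)"
        using regular[OF x] by (simp add: directionally_lipschitzian_def graph_pt_def)
      obtain \<delta>' where \<delta>': "\<delta>' > 0" "ball x \<delta>' \<subseteq> U" using open_U x(1) open_contains_ball by blast
      \<comment> \<open>Within \<open>\<delta>\<close> the hypothesis \<open>off\<close> is
        available, within \<open>\<delta>'\<close> base points remain in \<open>U\<close>, and
        \<open>1 / real (Suc n)\<close> forces convergence.\<close>
      define \<eta> where "\<eta> n = min (min \<delta> \<delta>') (1 / real (Suc n))" for n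
      have \<eta>: "\<eta> n > 0" for n using \<delta> \<delta>' by (simp add: \<eta>_def)
      have "\<exists>y w. y \<in> epi f \<and> y \<notin> graph_pt f ` M \<and> dist y (graph_pt f x) < \<eta> n \<and>
          w \<in> frechet_normal_cone (epi f) y \<and> dist w b < \<eta> n" for n
      proof (rule frechet_normal_accessible[OF lc zQ _ _ \<eta>])
        show "b \<in> ?C" using b by (simp add: boundary_in_def)
        fix e :: real assume "e > 0"
        with b obtain b' where "b' \<in> L" "dist b' b < e" "b' \<notin> ?C" unfolding boundary_in_def by blast
        with prox show "\<exists>b'. dist b' b < e \<and> b' \<notin> ?C \<and> (\<exists>C d. d > 0 \<and>
            (\<forall>p\<in>graph_pt f ` M. dist p (graph_pt f x) < d \<longrightarrow>
              b' \<bullet> (p - graph_pt f x) \<le> C * (norm (p - graph_pt f x))\<^sup>2))" by blast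
      qed
      then obtain Y W where YW: "\<And>n. Y n \<in> epi f" "\<And>n. Y n \<notin> graph_pt f ` M"
        "\<And>n. dist (Y n) (graph_pt f x) < \<eta> n" "\<And>n. W n \<in> frechet_normal_cone (epi f) (Y n)"
        "\<And>n. dist (W n) b < \<eta> n" by metis
      have lim: "Z \<longlonglongrightarrow> z" if "\<And>n. dist (Z n) z < \<eta> n" for Z :: "nat \<Rightarrow> 'a \<times> real" and z
      proof (rule metric_tendsto_imp_tendsto[of "\<lambda>n. 1 / real (Suc n)" 0])
        show "(\<lambda>n. 1 / real (Suc n)) \<longlonglongrightarrow> 0" by (rule LIMSEQ_Suc[OF lim_1_over_n])
        show "\<forall>\<^sub>F n in sequentially. dist (Z n) z \<le> dist (1 / real (Suc n)) 0"
          using that by (intro always_eventually allI) (auto simp: \<eta>_def intro: less_imp_le)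
      qed
      show "b \<in> convex_cone hull (generators f \<Omega> x)"
      proof (rule limit_in_hull[OF x YW(1) lim[OF YW(3)] YW(4) lim[OF YW(5)]])
        fix n assume eq: "Y n = graph_pt f (fst (Y n))"
        have "dist (fst (Y n)) x < \<eta> n"
          using YW(3)[of n] dist_fst_le[of "Y n" "graph_pt f x"] by (simp add: graph_pt_def)
        then have "dist (fst (Y n)) x < \<delta>" "fst (Y n) \<in> U"
          using \<delta>'(2) by (auto simp: \<eta>_def dist_commute)
        \<comment> \<open>A graph point outside the graph over \<open>M\<close> has its base point
          off \<open>M\<close>, where \<open>off\<close> applies.\<close>
        moreover have "fst (Y n) \<notin> M" using YW(2)[of n] eq by (metis image_eqI)
        ultimately show "W n \<in> convex_cone hull (generators f \<Omega> (fst (Y n)))"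
          using off[OF _ epi_imp_edom[OF YW(1)]] YW(4)[of n] eq by (metis subsetD)
      qed
    qed
    finally show ?thesis .
  qed
qed

text \<open>Finitely many closures avoid \<open>x\<close>, so close to \<open>x\<close> no further
  stratum becomes adherent, while off \<open>M\<close> the stratum \<open>M\<close> itself drops
  out. The number of adherent strata thus decreases strictly.\<close>

lemma frechet_subset_hull:
  assumes strata: "\<Union>\<M> = edom f" "\<And>M. M \<in> \<M> \<Longrightarrow> C2_submanifold M"
      "\<And>M. M \<in> \<M> \<Longrightarrow> C2_smooth_on_stratum f M"
    and fin: "finite {M \<in> \<M>. M \<inter> U \<noteq> {}}"
    and x: "x \<in> U" "x \<in> edom f"
  shows "frechet_normal_cone (epi f) (graph_pt f x) \<subseteq> convex_cone hull (generators f \<Omega> x)"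
  using x
proof (induction "card {M \<in> \<M>. M \<inter> U \<noteq> {} \<and> x \<in> closure M}" arbitrary: x rule: less_induct)
  case (less x)
  define F where "F y = {M \<in> \<M>. M \<inter> U \<noteq> {} \<and> y \<in> closure M}" for y
  have finF: "finite (F y)" for y by (rule finite_subset[OF _ fin]) (auto simp: F_def)
  obtain M where M: "M \<in> \<M>" "x \<in> M" using less.prems(2) strata(1) by blast
  obtain V where V: "open V" "x \<in> V" "closure M \<inter> V \<subseteq> M"
    using C2_submanifold_locally_closed[OF strata(2)[OF M(1)] M(2)] by blast
  \<comment> \<open>The strata meeting \<open>U\<close> but not adherent to \<open>x\<close>.
    Finiteness makes the union of their closures closed, so a whole ball around \<open>x\<close>
    avoids it.\<close>
  define S where "S = \<Union>(closure ` ({M \<in> \<M>. M \<inter> U \<noteq> {}} - F x))"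
  have "closed S" unfolding S_def using fin by (intro closed_Union) auto
  moreover have "x \<notin> S" by (auto simp: S_def F_def)
  ultimately have "open (V - S)" "x \<in> V - S" using V by (auto intro: open_Diff)
  then obtain \<delta> where \<delta>: "\<delta> > 0" "ball x \<delta> \<subseteq> V - S" using open_contains_ball by blast
  show ?case
  proof (rule stratum_normals[OF less.prems strata(2,3)[OF M(1)] M(2) \<delta>(1)])
    fix y assume y: "y \<in> U" "y \<in> edom f" "y \<notin> M" "dist y x < \<delta>"
    then have yV: "y \<in> V" "y \<notin> S" using \<delta>(2) by (auto simp: dist_commute)
    have "F y \<subseteq> F x" using yV(2) by (auto simp: S_def F_def)
    moreover have "M \<in> F x" using M less.prems(1) closure_subset by (auto simp: F_def)
    moreover have "M \<notin> F y" using y(3) yV(1) V(3) by (auto simp: F_def)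
    ultimately have "card (F y) < card (F x)" using finF by (intro psubset_card_mono) auto
    then show "frechet_normal_cone (epi f) (graph_pt f y) \<subseteq> convex_cone hull (generators f \<Omega> y)"
      using less.hyps[of y] y by (simp add: F_def)
  qed
qed

end

section \<open>Limits of unit normals\<close>

lemma norm_gradient_normal: "norm (g, -1 :: real) = sqrt (1 + (norm g)\<^sup>2)"
  by (simp add: norm_Pair add.commute)

lemma unit_gradient_normal:
  fixes g :: "'a::real_inner"
  assumes "c > 0"
  shows "(1 / norm (c *\<^sub>R (g, -1 :: real))) *\<^sub>R (c *\<^sub>R (g, -1)) = (1 / sqrt (1 + (norm g)\<^sup>2)) *\<^sub>R (g, -1)"
  using assms by (simp add: norm_gradient_normal[symmetric] del: scaleR_Pair)

lemma limit_gradient_in_hull: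
  assumes "v \<in> limit_gradients f \<Omega> x"
  shows "(v, -1) \<in> convex_cone hull (limit_unit_normals f \<Omega> x)"
proof -
  from assms obtain X G where XG: "grad_seq f \<Omega> x X G" "G \<longlonglongrightarrow> v"
    unfolding limit_gradients_def by blast
  have pos: "sqrt (1 + (norm u)\<^sup>2) > 0" for u :: 'a by (simp add: add_pos_nonneg)
  have "(\<lambda>i. (1 / sqrt (1 + (norm (G i))\<^sup>2)) *\<^sub>R (G i, -1 :: real)) \<longlonglongrightarrow>
      (1 / sqrt (1 + (norm v)\<^sup>2)) *\<^sub>R (v, -1)"
    using XG(2) pos[of v] by (intro tendsto_intros) auto
  then have "(1 / sqrt (1 + (norm v)\<^sup>2)) *\<^sub>R (v, -1) \<in> limit_unit_normals f \<Omega> x"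
    unfolding limit_unit_normals_def using XG(1) by blast
  from convex_cone_hull_mul[OF hull_inc[OF this] less_imp_le[OF pos[of v]]]
  show ?thesis using pos[of v] by (simp del: scaleR_Pair)
qed

text \<open>For \<open>v \<noteq> 0\<close> the factors \<open>t i\<close> cancel on normalising,
  and the unit normals converge to a positive multiple of \<open>(v, 0)\<close>. For
  \<open>v = 0\<close> normalising fails, but the hull always contains 0.\<close>

lemma limit_scaled_gradient_in_hull:
  assumes "v \<in> limit_scaled_gradients f \<Omega> x"
  shows "(v, 0) \<in> convex_cone hull (limit_unit_normals f \<Omega> x)"
proof (cases "v = 0")
  case True
  then show ?thesis using convex_cone_hull_contains_0 by (simp add: zero_prod_def[symmetric])
next
  case False
  from assms obtain X G t where XG: "grad_seq f \<Omega> x X G" "\<And>i. (0::real) < t i" "t \<longlonglongrightarrow> 0"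
    "(\<lambda>i. t i *\<^sub>R G i) \<longlonglongrightarrow> v"
    unfolding limit_scaled_gradients_def by blast
  let ?W = "\<lambda>i. t i *\<^sub>R (G i, -1 :: real)"
  have "(\<lambda>i. (t i *\<^sub>R G i, - t i)) \<longlonglongrightarrow> (v, - 0)" using XG(3,4) by (intro tendsto_intros)
  then have W: "?W \<longlonglongrightarrow> (v, 0)" by simp
  have n: "norm (v, 0 :: real) \<noteq> 0" using False by (simp add: zero_prod_def)
  have "(\<lambda>i. (1 / norm (?W i)) *\<^sub>R ?W i) \<longlonglongrightarrow> (1 / norm (v, 0 :: real)) *\<^sub>R (v, 0)"
    by (intro tendsto_intros W n)
  then have "(1 / norm (v, 0 :: real)) *\<^sub>R (v, 0) \<in> limit_unit_normals f \<Omega> x"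
    unfolding limit_unit_normals_def unit_gradient_normal[OF XG(2)] using XG(1) by blast
  from convex_cone_hull_mul[OF hull_inc[OF this] norm_ge_zero[of "(v, 0 :: real)"]]
  show ?thesis using n by (simp del: scaleR_Pair)
qed

text \<open>The last coordinate of the limit decides. If it is nonzero, dividing by it shows that
  the gradients converge; if it is 0, the normalising factors themselves are scales
  \<open>t i\<close> tending to 0.\<close>

lemma limit_unit_normals_subset:
  fixes f :: "'a::real_inner \<Rightarrow> ereal"
  shows "limit_unit_normals f \<Omega> x \<subseteq>
    convex_cone hull (limit_gradients f \<Omega> x \<times> {-1} \<union> limit_scaled_gradients f \<Omega> x \<times> {0})"
    (is "_ \<subseteq> convex_cone hull ?A")
proof
  fix u assume "u \<in> limit_unit_normals f \<Omega> x"
  then obtain X G where XG: "grad_seq f \<Omega> x X G"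
    and lim: "(\<lambda>i. (1 / sqrt (1 + (norm (G i))\<^sup>2)) *\<^sub>R (G i, -1)) \<longlonglongrightarrow> u"
    unfolding limit_unit_normals_def by blast
  define t where "t i = 1 / sqrt (1 + (norm (G i))\<^sup>2)" for i
  have t: "t i > 0" for i by (simp add: t_def add_pos_nonneg)
  have 1: "(\<lambda>i. t i *\<^sub>R G i) \<longlonglongrightarrow> fst u" using tendsto_fst[OF lim] by (simp add: t_def)
  have 2: "t \<longlonglongrightarrow> - snd u" using tendsto_minus[OF tendsto_snd[OF lim]] by (simp add: t_def[abs_def])
  have le: "0 \<le> - snd u" using t by (intro LIMSEQ_le_const[OF 2]) (auto intro: less_imp_le)
  show "u \<in> convex_cone hull ?A"
  proof (cases "snd u = 0")
    case True
    with 1 2 XG t have "fst u \<in> limit_scaled_gradients f \<Omega> x"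
      unfolding limit_scaled_gradients_def by auto
    with True show ?thesis by (intro hull_inc) (auto simp: mem_Times_iff)
  next
    case False
    have "(\<lambda>i. (1 / t i) *\<^sub>R (t i *\<^sub>R G i)) \<longlonglongrightarrow> (1 / - snd u) *\<^sub>R fst u"
      using False by (intro tendsto_intros 1 2) auto
    moreover have "(1 / t i) *\<^sub>R (t i *\<^sub>R G i) = G i" for i using t[of i] by simp
    ultimately have "G \<longlonglongrightarrow> (1 / - snd u) *\<^sub>R fst u" by simp
    with XG have "((1 / - snd u) *\<^sub>R fst u, -1) \<in> ?A" unfolding limit_gradients_def by blast
    from convex_cone_hull_mul[OF hull_inc[OF this] le] show ?thesis
      using False by simp
  qed
qed

text \<open>Generators can be taken at heights -1 and 0. Total height -1 forces the weights at
  height -1 to sum to 1, which gives a convex combination, and leaves the nonnegative weights at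
  height 0 free.\<close>

lemma convex_cone_hull_limit_unit_normals_slice:
  fixes f :: "'a::real_inner \<Rightarrow> ereal"
  shows "(v, -1) \<in> convex_cone hull (limit_unit_normals f \<Omega> x) \<longleftrightarrow>
    v \<in> convex hull (limit_gradients f \<Omega> x) + convex_cone hull (limit_scaled_gradients f \<Omega> x)"
    (is "_ \<in> convex_cone hull ?U \<longleftrightarrow> _ \<in> convex hull ?G + convex_cone hull ?S")
proof -
  have "linear (\<lambda>v::'a. (v, 0::real))" by (intro linearI) auto
  moreover have "(\<lambda>v::'a. (v, 0::real)) ` B = B \<times> {0}" for B by auto
  ultimately have S: "convex_cone hull (?S \<times> {0::real}) = (convex_cone hull ?S) \<times> {0}"
    using convex_cone_hull_linear_image[of "\<lambda>v::'a. (v, 0::real)" ?S] by simp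
  have G: "convex hull (?G \<times> {-1::real}) = (convex hull ?G) \<times> {-1}"
    by (simp add: convex_hull_Times)
  show ?thesis
  proof
    assume "(v, -1) \<in> convex_cone hull ?U"
    also have "convex_cone hull ?U \<subseteq> convex_cone hull (?G \<times> {-1} \<union> ?S \<times> {0})"
      by (intro hull_minimal limit_unit_normals_subset convex_cone_convex_cone_hull)
    finally obtain a b where ab: "a \<in> convex_cone hull (?G \<times> {-1})" "b \<in> (convex_cone hull ?S) \<times> {0}"
      "(v, -1 :: real) = a + b" unfolding convex_cone_hull_Un S by blast
    from ab(2,3) have "snd a = -1" by (auto simp: prod_eq_iff)
    \<comment> \<open>Comparing last coordinates excludes \<open>a = 0\<close> and forces
      \<open>c = 1\<close>. In particular both sides of the equivalence are false when there are no
      limits of gradients.\<close>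
    moreover from ab(1) have "a = 0 \<or> (\<exists>y c. y \<in> convex hull ?G \<and> a = c *\<^sub>R (y, -1))"
      unfolding convex_cone_hull_convex_hull G by auto
    ultimately obtain y where "y \<in> convex hull ?G" "a = (y, -1)" by fastforce
    with ab(2,3) show "v \<in> convex hull ?G + convex_cone hull ?S"
      by (auto intro: set_plus_intro)
  next
    assume "v \<in> convex hull ?G + convex_cone hull ?S"
    then obtain a b where ab: "a \<in> convex hull ?G" "b \<in> convex_cone hull ?S" "v = a + b"
      by (auto simp: set_plus_def)
    have "(a, -1 :: real) \<in> convex hull (?G \<times> {-1})" using ab(1) by (simp add: G)
    also have "\<dots> \<subseteq> convex_cone hull ?U"
      using limit_gradient_in_hull[of _ f \<Omega> x] convex_cone_convex_cone_hull[of ?U]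
      by (intro hull_minimal) (auto simp: convex_cone_def)
    finally have a: "(a, -1) \<in> convex_cone hull ?U" .
    have "(b, 0 :: real) \<in> convex_cone hull (?S \<times> {0})" using ab(2) by (simp add: S)
    also have "\<dots> \<subseteq> convex_cone hull ?U"
      using limit_scaled_gradient_in_hull[of _ f \<Omega> x]
      by (intro hull_minimal convex_cone_convex_cone_hull) auto
    finally have "(a, -1) + (b, 0) \<in> convex_cone hull ?U" by (intro convex_cone_hull_add a)
    with ab(3) show "(v, -1) \<in> convex_cone hull ?U" by simp
  qed
qed

section \<open>Comparison of the generators with limits of unit normals, and the normal cone
  formula\<close>

context regular_epigraph
begin

lemma grad_seq_graph_pt:
  assumes "x \<in> edom f" "grad_seq f \<Omega> x X G"
  shows "(\<lambda>i. graph_pt f (X i)) \<longlonglongrightarrow> graph_pt f x"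
proof -
  have X: "\<And>i. X i \<in> edom f" "X \<longlonglongrightarrow> x" "(\<lambda>i. f (X i)) \<longlonglongrightarrow> f x"
    using assms(2) Omega(1) by (auto simp: grad_seq_def)
  have "(\<lambda>i. ereal (real_of_ereal (f (X i)))) \<longlonglongrightarrow> ereal (real_of_ereal (f x))"
    using X(3) by (simp add: ereal_real_edom X(1) assms(1))
  then show ?thesis unfolding graph_pt_def using X(2) by (intro tendsto_Pair) simp_all
qed

lemma limit_unit_normals_subset_generators:
  assumes "x \<in> edom f"
  shows "limit_unit_normals f \<Omega> x \<subseteq> generators f \<Omega> x"
proof
  fix u assume "u \<in> limit_unit_normals f \<Omega> x"
  then obtain X G where XG: "grad_seq f \<Omega> x X G"
    and lim: "(\<lambda>i. (1 / sqrt (1 + (norm (G i))\<^sup>2)) *\<^sub>R (G i, -1)) \<longlonglongrightarrow> u"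
    unfolding limit_unit_normals_def by blast
  have "(graph_pt f (X i), (1 / sqrt (1 + (norm (G i))\<^sup>2)) *\<^sub>R (G i, -1)) \<in> gradient_normals f \<Omega>" for i
  proof -
    have "X i \<in> \<Omega>" "has_egradient f (X i) (G i)" using XG by (auto simp: grad_seq_def)
    moreover have "0 \<le> 1 / sqrt (1 + (norm (G i))\<^sup>2)" by simp
    ultimately show ?thesis unfolding gradient_normals_def by blast
  qed
  then have "(graph_pt f x, u) \<in> closure (gradient_normals f \<Omega>)"
    unfolding closure_sequential
    by (intro exI[of _ "\<lambda>i. (graph_pt f (X i), (1 / sqrt (1 + (norm (G i))\<^sup>2)) *\<^sub>R (G i, -1))"]
        conjI allI tendsto_Pair grad_seq_graph_pt[OF assms XG] lim)
  then show "u \<in> generators f \<Omega> x" by (simp add: generators_def)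
qed

text \<open>Along a sequence with nonzero limit \<open>w\<close> the factors \<open>c i\<close> are
  eventually positive and disappear on normalising, so \<open>w\<close> is \<open>norm w\<close>
  times a limit of unit normals.\<close>

lemma generators_subset_sum:
  assumes x: "x \<in> edom f"
  shows "generators f \<Omega> x \<subseteq>
    convex_cone hull (limit_unit_normals f \<Omega> x) \<union> limiting_normal_cone (edom f) x \<times> {0}"
proof -
  have "w \<in> convex_cone hull (limit_unit_normals f \<Omega> x)"
    if w: "(graph_pt f x, w) \<in> closure (gradient_normals f \<Omega>)" for w
  proof (cases "w = 0")
    case True
    then show ?thesis by (simp add: convex_cone_hull_contains_0)
  next
    case False
    from w obtain P where P: "\<And>i::nat. P i \<in> gradient_normals f \<Omega>" "P \<longlonglongrightarrow> (graph_pt f x, w)"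
      unfolding closure_sequential by blast
    have "\<forall>i. \<exists>y g c. P i = (graph_pt f y, c *\<^sub>R (g, -1)) \<and> y \<in> \<Omega> \<and> has_egradient f y g \<and> 0 \<le> c"
      using P(1) unfolding gradient_normals_def by blast
    then obtain X G c where XG: "\<And>i. P i = (graph_pt f (X i), c i *\<^sub>R (G i, -1))" "\<And>i. X i \<in> \<Omega>"
      "\<And>i. has_egradient f (X i) (G i)" "\<And>i. 0 \<le> c i" by metis
    have lim: "(\<lambda>i. c i *\<^sub>R (G i, -1)) \<longlonglongrightarrow> w" using tendsto_snd[OF P(2)] by (simp add: XG(1))
    have gl: "(\<lambda>i. graph_pt f (X i)) \<longlonglongrightarrow> graph_pt f x" using tendsto_fst[OF P(2)] by (simp add: XG(1))
    have "(\<lambda>i. ereal (real_of_ereal (f (X i)))) \<longlonglongrightarrow> ereal (real_of_ereal (f x))"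
      using tendsto_snd[OF gl] by (simp add: graph_pt_def)
    moreover have "X i \<in> edom f" for i using XG(2) Omega(1) by blast
    ultimately have "(\<lambda>i. f (X i)) \<longlonglongrightarrow> f x" using x by (simp add: ereal_real_edom)
    moreover have "X \<longlonglongrightarrow> x" using tendsto_fst[OF gl] by (simp add: graph_pt_def)
    ultimately have gs: "grad_seq f \<Omega> x X G" using XG by (auto simp: grad_seq_def)
    have "(\<lambda>i. (1 / norm (c i *\<^sub>R (G i, -1::real))) *\<^sub>R (c i *\<^sub>R (G i, -1))) \<longlonglongrightarrow> (1 / norm w) *\<^sub>R w"
      using False by (intro tendsto_intros lim) auto
    moreover have "\<forall>\<^sub>F i in sequentially. c i *\<^sub>R (G i, -1::real) \<noteq> 0"
      using tendsto_imp_eventually_ne[OF lim False] .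
    then have "\<forall>\<^sub>F i in sequentially. (1 / norm (c i *\<^sub>R (G i, -1::real))) *\<^sub>R (c i *\<^sub>R (G i, -1)) =
        (1 / sqrt (1 + (norm (G i))\<^sup>2)) *\<^sub>R (G i, -1)"
    proof eventually_elim
      case (elim i)
      then have "c i > 0" using XG(4)[of i] by (cases "c i = 0") (auto simp: zero_prod_def)
      then show ?case by (rule unit_gradient_normal)
    qed
    ultimately have "(\<lambda>i. (1 / sqrt (1 + (norm (G i))\<^sup>2)) *\<^sub>R (G i, -1)) \<longlonglongrightarrow> (1 / norm w) *\<^sub>R w"
      by (rule Lim_transform_eventually)
    then have "(1 / norm w) *\<^sub>R w \<in> limit_unit_normals f \<Omega> x"
      unfolding limit_unit_normals_def using gs by blast
    from convex_cone_hull_mul[OF hull_inc[OF this] norm_ge_zero[of w]] False show ?thesis by simp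
  qed
  then show ?thesis unfolding generators_def by blast
qed

text \<open>All limiting normals are in the hull of the generators, which is convex and, by
  pointedness, closed; hence it contains their closed convex hull. The converse inclusion only needs
  the left side to be a closed convex cone containing the generators.\<close>

theorem clarke_normal_cone_epi:
  assumes x: "x \<in> U" "x \<in> edom f"
    and hull: "\<And>y. y \<in> U \<Longrightarrow> y \<in> edom f \<Longrightarrow>
        frechet_normal_cone (epi f) (graph_pt f y) \<subseteq> convex_cone hull (generators f \<Omega> y)"
  shows "clarke_normal_cone (epi f) (graph_pt f x) =
    convex_cone hull (limit_unit_normals f \<Omega> x) + clarke_normal_cone (edom f) x \<times> {0}"
    (is "?N = ?U + ?D \<times> {0}")
proof
  let ?L = "limiting_normal_cone (epi f) (graph_pt f x)"
  have zQ: "graph_pt f x \<in> epi f" using x(2) finite_on_edom graph_pt_in_epi by metis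
  have N: "convex_cone ?N" by (rule convex_cone_clarke_normal_cone[OF zQ])
  have LN: "?L \<subseteq> ?N" unfolding clarke_normal_cone_def by (meson closure_subset hull_subset order_trans)
  show "?U + ?D \<times> {0} \<subseteq> ?N"
  proof -
    have "?U \<subseteq> ?N"
      using limit_unit_normals_subset_generators[OF x(2)] generators_subset[OF x] LN N
      by (intro hull_minimal) auto
    moreover have "?D \<times> {0} \<subseteq> ?N"
    proof -
      let ?h = "\<lambda>v::'a. (v, 0::real)"
      have lin: "linear ?h" by (intro linearI) auto
      have "?h ` (convex hull limiting_normal_cone (edom f) x)
          = convex hull (?h ` limiting_normal_cone (edom f) x)"
        by (rule convex_hull_linear_image[OF lin])
      also have "\<dots> \<subseteq> convex hull ?L"
        using dom_normals_subset[OF x] by (intro hull_mono) auto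
      also have "\<dots> \<subseteq> ?N" unfolding clarke_normal_cone_def by (rule closure_subset)
      \<comment> \<open>\<open>?D\<close> is a closure, so it is reached through continuity of
        \<open>?h\<close> and closedness of the right side.\<close>
      finally have "?h ` ?D \<subseteq> ?N"
        unfolding clarke_normal_cone_def
        by (intro image_closure_subset continuous_intros closed_closure)
      then show ?thesis by auto
    qed
    ultimately show ?thesis
      using convex_cone_add[OF N] unfolding set_plus_def by (smt (verit) mem_Collect_eq subset_iff)
  qed
  show "?N \<subseteq> ?U + ?D \<times> {0}"
  proof -
    let ?K = "convex_cone hull (generators f \<Omega> x)"
    have "?L \<subseteq> ?K"
    proof
      fix w assume "w \<in> ?L"
      then obtain Y W where YW: "\<And>i::nat. Y i \<in> epi f \<and> W i \<in> frechet_normal_cone (epi f) (Y i)"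
        "Y \<longlonglongrightarrow> graph_pt f x" "W \<longlonglongrightarrow> w" unfolding limiting_normal_cone_def by blast
      have "(\<lambda>i. fst (Y i)) \<longlonglongrightarrow> x" using tendsto_fst[OF YW(2)] by (simp add: graph_pt_def)
      then have "\<forall>\<^sub>F i in sequentially. fst (Y i) \<in> U" using topological_tendstoD open_U x(1) by blast
      then obtain m where m: "\<And>i. i \<ge> m \<Longrightarrow> fst (Y i) \<in> U" unfolding eventually_sequentially by blast
      show "w \<in> ?K"
      \<comment> \<open>The shift by \<open>m\<close> discards the initial terms, whose base points
        may lie outside \<open>U\<close>.\<close>
      proof (rule limit_in_hull[OF x, where Y = "\<lambda>i. Y (i + m)" and W = "\<lambda>i. W (i + m)"])
        fix i assume "Y (i + m) = graph_pt f (fst (Y (i + m)))"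
        then show "W (i + m) \<in> convex_cone hull (generators f \<Omega> (fst (Y (i + m))))"
          using hull[OF m epi_imp_edom] YW(1)[of "i + m"] by (metis le_add2 subsetD)
      qed (use YW LIMSEQ_ignore_initial_segment in auto)
    qed
    then have "convex hull ?L \<subseteq> ?K"
      using convex_cone_convex_cone_hull by (intro hull_minimal) (auto simp: convex_cone_def)
    moreover have "closed ?K"
      using closed_convex_cone_hull_cone[OF closed_generators generators_scaleR generators_pointed[OF x]] .
    ultimately have "?N \<subseteq> ?K" unfolding clarke_normal_cone_def by (rule closure_minimal)
    also have "?K \<subseteq> convex_cone hull (?U \<union> ?D \<times> {0})"
    proof (rule hull_mono)
      have "limiting_normal_cone (edom f) x \<subseteq> ?D"
        unfolding clarke_normal_cone_def by (meson closure_subset hull_subset order_trans)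
      then show "generators f \<Omega> x \<subseteq> ?U \<union> ?D \<times> {0}" using generators_subset_sum[OF x(2)] by blast
    qed
    also have "\<dots> = ?U + ?D \<times> {0}"
    proof -
      \<comment> \<open>Both summands are convex cones, and the conical hull of a union is the sum
        of the hulls.\<close>
      have "convex_cone (?D \<times> {0::real})"
        by (intro convex_cone_Times convex_cone_clarke_normal_cone x(2) convex_cone_singleton)
      then have "convex_cone hull (?D \<times> {0::real}) = ?D \<times> {0}"
        by (simp add: hull_same)
      then show ?thesis
        unfolding convex_cone_hull_Un by (auto simp: set_plus_def hull_hull)
    qed
    finally show ?thesis .
  qed
qed

end

theorem theorem3p10:
  fixes f :: "real ^ 'n \<Rightarrow> ereal" and xbar :: "real ^ 'n" and \<Omega> :: "(real ^ 'n) set"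
  assumes "proper_fun f"
    and "stratifiable f"
    and "\<bar>f xbar\<bar> \<noteq> \<infinity>"
    and "\<exists>U. open U \<and> xbar \<in> U \<and>
           (\<forall>y \<in> U \<inter> edom f. vertically_continuous f y \<and> directionally_lipschitzian f y)"
    and "\<Omega> \<subseteq> edom f" and "edom f \<subseteq> closure \<Omega>"
  shows "clarke_normal_cone (epi f) (xbar, real_of_ereal (f xbar)) =
           (convex_cone hull (limit_unit_normals f \<Omega> xbar))
           + (clarke_normal_cone (edom f) xbar \<times> {0})
         \<and> clarke_subdiff f xbar =
           (convex hull (limit_gradients f \<Omega> xbar))
           + (convex_cone hull (limit_scaled_gradients f \<Omega> xbar))
           + clarke_normal_cone (edom f) xbar"
proof -
  obtain U1 where U1: "open U1" "xbar \<in> U1"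
    "\<And>y. y \<in> U1 \<Longrightarrow> y \<in> edom f \<Longrightarrow> vertically_continuous f y \<and> directionally_lipschitzian f y"
    using assms(4) by blast
  obtain \<M> where strat: "locally_finite_stratification (edom f) \<M>"
    and smooth: "\<And>M. M \<in> \<M> \<Longrightarrow> C2_smooth_on_stratum f M"
    using assms(2) unfolding stratifiable_def by blast
  have xd: "xbar \<in> edom f" using assms(3) by (auto simp: edom_def)
  then obtain U2 where U2: "open U2" "xbar \<in> U2" "finite {M \<in> \<M>. M \<inter> U2 \<noteq> {}}"
    using strat unfolding locally_finite_stratification_def by blast
  \<comment> \<open>On \<open>U1\<close> the function is regular, and \<open>U2\<close> meets
    finitely many strata; the induction over strata uses both.\<close>
  interpret regular_epigraph f \<Omega> "U1 \<inter> U2"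
    by unfold_locales (use assms U1 U2 in auto)
  have "frechet_normal_cone (epi f) (graph_pt f y) \<subseteq> convex_cone hull (generators f \<Omega> y)"
    if "y \<in> U1 \<inter> U2" "y \<in> edom f" for y
  proof (rule frechet_subset_hull[OF _ _ smooth _ that])
    show "\<Union>\<M> = edom f" using strat by (simp add: locally_finite_stratification_def partition_on_def)
    show "finite {M \<in> \<M>. M \<inter> (U1 \<inter> U2) \<noteq> {}}" by (rule finite_subset[OF _ U2(3)]) auto
  qed (use strat in \<open>auto simp: locally_finite_stratification_def\<close>)
  then have N: "clarke_normal_cone (epi f) (xbar, real_of_ereal (f xbar)) =
      convex_cone hull (limit_unit_normals f \<Omega> xbar) + clarke_normal_cone (edom f) xbar \<times> {0}"
    using clarke_normal_cone_epi[of xbar] U1(2) U2(2) xd by (simp add: graph_pt_def)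
  \<comment> \<open>Adding a horizontal vector leaves the last coordinate unchanged, so slicing at
    height -1 commutes with adding \<open>D \<times> {0}\<close>.\<close>
  have "(v, -1) \<in> A + D \<times> {0::real} \<longleftrightarrow> v \<in> {u. (u, -1) \<in> A} + D" for v and A and D :: "(real ^ 'n) set"
  proof
    assume "(v, -1) \<in> A + D \<times> {0::real}"
    then obtain u d where "u \<in> A" "d \<in> D" "(v, -1) = u + (d, 0)" by (auto simp: set_plus_def)
    then show "v \<in> {u. (u, -1) \<in> A} + D" by (cases u) (auto simp: set_plus_def)
  next
    assume "v \<in> {u. (u, -1) \<in> A} + D"
    then obtain u d where "(u, -1) \<in> A" "d \<in> D" "v = u + d" by (auto simp: set_plus_def)
    then have "(u, -1) + (d, 0) \<in> A + D \<times> {0::real}" by (intro set_plus_intro) auto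
    with \<open>v = u + d\<close> show "(v, -1) \<in> A + D \<times> {0::real}" by simp
  qed
  then have "clarke_subdiff f xbar = {u. (u, -1) \<in> convex_cone hull (limit_unit_normals f \<Omega> xbar)}
      + clarke_normal_cone (edom f) xbar"
    unfolding clarke_subdiff_def N by blast
  also have "{u. (u, -1) \<in> convex_cone hull (limit_unit_normals f \<Omega> xbar)} =
      convex hull (limit_gradients f \<Omega> xbar) + convex_cone hull (limit_scaled_gradients f \<Omega> xbar)"
    unfolding convex_cone_hull_limit_unit_normals_slice by simp
  finally show ?thesis using N by blast
qed

end
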